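(* Let $n\ge 12$ be an integer divisible by $6$, and let $I_n\subseteq \mathbb{C}[x,y,z]$ be the homogeneous defining (radical) ideal of the set $\mathcal{B}_n\subset\mathbb{P}^2_{\mathbb{C}}$ of triple points of the Böröczky configuration of size $n$. Let $d$ be the smallest non-negative integer satisfying $$\left\lfloor \frac{d^2}{12}+\frac{d}{2}\right\rfloor\ \ge\ \frac{(n-6)^2}{36}.$$ Then $$\frac{n}{3}\ \le\ \alpha(I_n)\ \le\ d+3 .$$
   Context: Böröczky configuration. For a real number $\theta$ let $P_\theta=(\cos\theta,\sin\theta)$ be the point of the unit circle in $\mathbb{R}^2$ with angle $\theta$. For $n\ge 3$ and $0\le j\le n-1$, let $L_j$ be the line through $P_{2\pi j/n}$ and $P_{\pi-4\pi j/n}$ if these points are distinct, and the tangent line to the unit circle at $P_{2\pi j/n}$ if they coincide. Let $\mathcal{L}_n=\{L_j: 0\le j\le n-1\}$. A triple point is a point of the plane where exactly three lines of $\mathcal{L}_n$ meet; $\mathcal{B}_n$ denotes the set of triple points, viewed in $\mathbb{P}^2_{\mathbb{C}}$ via $(a,b)\mapsto[a:b:1]$. For a nonzero homogeneous ideal $J$, $\alpha(J)$ denotes the smallest degree of a nonzero element of $J$. *)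

theory Defs
  imports "HOL-Analysis.Analysis" "HOL-Library.Poly_Mapping"
begin

text \<open>
  A polynomial in \<open>\<complex>[x,y,z]\<close> is a finitely supported map from exponent vectors to coefficients;
  the variables \<open>x, y, z\<close> are indexed by the three-element type \<open>3\<close>, whose elements are
  \<open>1, 2\<close> and \<open>3 = 0\<close>. The ring structure is the convolution ring of Poly_Mapping.
\<close>

type_synonym cpoly3 = "(3 \<Rightarrow>\<^sub>0 nat) \<Rightarrow>\<^sub>0 complex"

definition eval_poly :: "cpoly3 \<Rightarrow> complex ^ 3 \<Rightarrow> complex" where
  "eval_poly f v =
     (\<Sum>m\<in>Poly_Mapping.keys f. Poly_Mapping.lookup f m * (\<Prod>i\<in>UNIV. (v $ i) ^ Poly_Mapping.lookup m i))"

text \<open>The total degree; only meaningful for \<open>f \<noteq> 0\<close>.\<close>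

definition total_degree :: "cpoly3 \<Rightarrow> nat" where
  "total_degree f = Max ((\<lambda>m. \<Sum>i\<in>UNIV. Poly_Mapping.lookup m i) ` Poly_Mapping.keys f)"

definition initial_degree :: "cpoly3 set \<Rightarrow> nat" where
  "initial_degree J = (LEAST d. \<exists>f\<in>J. f \<noteq> 0 \<and> total_degree f = d)"

text \<open>
  A point of \<open>\<P>\<^sup>2\<close> over \<open>\<complex>\<close> is an equivalence class of nonzero vectors, that is,
  the set of all its homogeneous coordinate vectors.
\<close>

definition proj_rel :: "((complex ^ 3) \<times> (complex ^ 3)) set" where
  "proj_rel = {(v, w). v \<noteq> 0 \<and> w \<noteq> 0 \<and> (\<exists>c. c \<noteq> 0 \<and> w = c *s v)}"

definition proj_plane :: "(complex ^ 3) set set" where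
  "proj_plane = (UNIV - {0}) // proj_rel"

lemma equiv_proj_rel: "equiv (UNIV - {0}) proj_rel"
proof (rule equivI)
  show "proj_rel \<subseteq> (UNIV - {0}) \<times> (UNIV - {0})"
    by (auto simp: proj_rel_def)
  show "refl_on (UNIV - {0}) proj_rel"
    by (auto simp: refl_on_def proj_rel_def intro!: exI[of _ 1])
  show "sym proj_rel"
  proof (rule symI)
    fix v w assume "(v, w) \<in> proj_rel"
    then obtain c where "v \<noteq> 0" "w \<noteq> 0" "c \<noteq> 0" "w = c *s v"
      by (auto simp: proj_rel_def)
    then show "(w, v) \<in> proj_rel"
      by (auto simp: proj_rel_def intro!: exI[of _ "inverse c"])
  qed
  show "trans proj_rel"
  proof (rule transI)
    fix u v w assume "(u, v) \<in> proj_rel" "(v, w) \<in> proj_rel"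
    then obtain c d where "u \<noteq> 0" "w \<noteq> 0" "c \<noteq> 0" "v = c *s u" "d \<noteq> 0" "w = d *s v"
      by (auto simp: proj_rel_def)
    then show "(u, w) \<in> proj_rel"
      by (auto simp: proj_rel_def intro!: exI[of _ "d * c"])
  qed
qed

text \<open>The embedding \<open>(a,b) \<mapsto> [a:b:1]\<close> of the real affine plane.\<close>

definition embed_proj :: "real ^ 2 \<Rightarrow> (complex ^ 3) set" where
  "embed_proj p = proj_rel `` {vector [complex_of_real (p $ 1), complex_of_real (p $ 2), 1]}"

lemma embed_proj_in_proj_plane: "embed_proj p \<in> proj_plane"
proof -
  have "(vector [complex_of_real (p $ 1), complex_of_real (p $ 2), 1] :: complex ^ 3) $ 3 \<noteq> 0 $ 3"
    by simp
  then have "(vector [complex_of_real (p $ 1), complex_of_real (p $ 2), 1] :: complex ^ 3) \<noteq> 0"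
    by metis
  then show ?thesis
    unfolding embed_proj_def proj_plane_def by (intro quotientI) simp
qed

text \<open>
  The ideal of a set of projective points: all polynomials vanishing at every homogeneous coordinate
  vector of every point. As \<open>\<complex>\<close> is infinite, this is a homogeneous ideal; it is the
  ideal generated by the homogeneous polynomials vanishing on \<open>Y\<close>, and it is clearly radical.
\<close>

definition vanishing_ideal :: "(complex ^ 3) set set \<Rightarrow> cpoly3 set" where
  "vanishing_ideal Y = {f. \<forall>Q\<in>Y. \<forall>v\<in>Q. eval_poly f v = 0}"

definition circle_point :: "real \<Rightarrow> real ^ 2" where
  "circle_point \<theta> = vector [cos \<theta>, sin \<theta>]"

definition circle_tangent :: "real \<Rightarrow> (real ^ 2) set" where
  "circle_tangent \<theta> = {circle_point \<theta> + t *\<^sub>R vector [- sin \<theta>, cos \<theta>] | t. True}"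

definition boroczky_line :: "nat \<Rightarrow> nat \<Rightarrow> (real ^ 2) set" where
  "boroczky_line n j =
     (let \<alpha> = 2 * pi * real j / real n; \<beta> = pi - 4 * pi * real j / real n
      in if circle_point \<alpha> \<noteq> circle_point \<beta>
         then affine hull {circle_point \<alpha>, circle_point \<beta>}
         else circle_tangent \<alpha>)"

definition boroczky_lines :: "nat \<Rightarrow> (real ^ 2) set set" where
  "boroczky_lines n = boroczky_line n ` {0..n - 1}"

definition triple_points :: "nat \<Rightarrow> (real ^ 2) set" where
  "triple_points n = {p. card {l \<in> boroczky_lines n. p \<in> l} = 3}"

definition boroczky_points :: "nat \<Rightarrow> (complex ^ 3) set set" where
  "boroczky_points n = embed_proj ` triple_points n"

definition boroczky_ideal :: "nat \<Rightarrow> cpoly3 set" where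
  "boroczky_ideal n = vanishing_ideal (boroczky_points n)"

end

theory Submission
  imports Defs "HOL-Computational_Algebra.Polynomial"
begin

text \<open>
  In the complex coordinate \<open>u\<close> of the real plane, the lines \<open>L\<^sub>j\<close> through \<open>u\<close> correspond to the \<open>n\<close>-th roots of
  unity among the roots of \<open>E\<^sup>3 - u E\<^sup>2 + cnj u E - 1\<close>. Hence the triple points are the sums of three distinct
  \<open>n\<close>-th roots of unity with product \<open>1\<close>.

  Lower bound: write \<open>n = 6m\<close>. Each of the \<open>3m\<close> lines with odd index carries at least \<open>3m - 1 \<ge> 2m\<close> triple
  points, so a polynomial of degree less than \<open>2m\<close> in the ideal vanishes on all these lines, hence on almost every
  horizontal line, hence everywhere.

  Upper bound: the configuration is invariant under the dihedral group of order \<open>6\<close>, and its triple points off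
  the three reflection axes form at most \<open>(m - 1)\<^sup>2\<close> orbits. There are more than \<open>d\<^sup>2/12 + d/2\<close> linearly
  independent invariant forms of degree \<open>d\<close>, so some nonzero invariant vanishes on all these orbits. Its
  product with the equations of the three axes lies in the ideal.
\<close>

section \<open>Polynomials as functions\<close>

definition monomial_value :: "(3 \<Rightarrow>\<^sub>0 nat) \<Rightarrow> complex ^ 3 \<Rightarrow> complex" where
  "monomial_value m v = (\<Prod>i\<in>UNIV. (v $ i) ^ Poly_Mapping.lookup m i)"

lemma monomial_value_add: "monomial_value (a + b) v = monomial_value a v * monomial_value b v"
  by (simp add: monomial_value_def lookup_add power_add prod.distrib)

lemma prod_UNIV_3: "(\<Prod>i\<in>(UNIV :: 3 set). f i) = f 1 * f 2 * (f 3 :: 'a :: comm_monoid_mult)"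
  unfolding UNIV_3 by (simp add: mult.assoc)

lemma eval_poly_superset:
  assumes "finite S" "Poly_Mapping.keys f \<subseteq> S"
  shows "eval_poly f v = (\<Sum>m\<in>S. Poly_Mapping.lookup f m * monomial_value m v)"
  unfolding eval_poly_def monomial_value_def
  by (rule sum.mono_neutral_left) (use assms in \<open>auto simp: in_keys_iff\<close>)

lemma eval_poly_zero [simp]: "eval_poly 0 v = 0"
  by (simp add: eval_poly_def)

lemma eval_poly_single [simp]: "eval_poly (Poly_Mapping.single m c) v = c * monomial_value m v"
  by (subst eval_poly_superset[of "{m}"]) (auto simp: keys_single)

lemma eval_poly_add: "eval_poly (f + g) v = eval_poly f v + eval_poly g v"
proof -
  let ?S = "Poly_Mapping.keys f \<union> Poly_Mapping.keys g"
  have "Poly_Mapping.keys (f + g) \<subseteq> ?S" by (rule Poly_Mapping.keys_add)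
  then show ?thesis
    by (simp add: eval_poly_superset[of ?S] lookup_add algebra_simps sum.distrib)
qed

lemma eval_poly_sum: "eval_poly (\<Sum>x\<in>A. f x) v = (\<Sum>x\<in>A. eval_poly (f x) v)"
  by (induction A rule: infinite_finite_induct) (auto simp: eval_poly_add)

lemma poly_mapping_eq_sum_single:
  fixes f :: "'a \<Rightarrow>\<^sub>0 'b::comm_monoid_add"
  shows "f = (\<Sum>a\<in>Poly_Mapping.keys f. Poly_Mapping.single a (Poly_Mapping.lookup f a))"
proof (rule poly_mapping_eqI)
  fix k
  have "Poly_Mapping.lookup (\<Sum>a\<in>A. g a) k = (\<Sum>a\<in>A. Poly_Mapping.lookup (g a) k)"
    for A :: "'a set" and g :: "'a \<Rightarrow> 'a \<Rightarrow>\<^sub>0 'b"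
    by (induction A rule: infinite_finite_induct) (auto simp: lookup_add)
  then show "Poly_Mapping.lookup f k =
      Poly_Mapping.lookup (\<Sum>a\<in>Poly_Mapping.keys f. Poly_Mapping.single a (Poly_Mapping.lookup f a)) k"
    by (auto simp: lookup_single when_def sum.delta in_keys_iff)
qed

lemma eval_poly_mult: "eval_poly (f * g) v = eval_poly f v * eval_poly g v"
proof -
  have "f * g = (\<Sum>a\<in>Poly_Mapping.keys f. \<Sum>b\<in>Poly_Mapping.keys g.
      Poly_Mapping.single (a + b) (Poly_Mapping.lookup f a * Poly_Mapping.lookup g b))"
    by (subst (1) poly_mapping_eq_sum_single[of f], subst (1) poly_mapping_eq_sum_single[of g])
      (simp add: sum_product mult_single)
  then have "eval_poly (f * g) v =
     (\<Sum>a\<in>Poly_Mapping.keys f. \<Sum>b\<in>Poly_Mapping.keys g.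
        (Poly_Mapping.lookup f a * monomial_value a v) * (Poly_Mapping.lookup g b * monomial_value b v))"
    by (simp add: eval_poly_sum monomial_value_add mult_ac)
  also have "\<dots> = eval_poly f v * eval_poly g v"
    by (simp add: eval_poly_superset[OF finite_keys order_refl] sum_product)
  finally show ?thesis .
qed

lemma eval_poly_one [simp]: "eval_poly 1 v = 1"
  using eval_poly_single[of 0 1 v] by (simp add: monomial_value_def)

lemma eval_poly_power: "eval_poly (f ^ k) v = eval_poly f v ^ k"
  by (induction k) (auto simp: eval_poly_mult)

definition Var :: "3 \<Rightarrow> cpoly3" where
  "Var i = Poly_Mapping.single (Poly_Mapping.single i 1) 1"

definition Const :: "complex \<Rightarrow> cpoly3" where
  "Const c = Poly_Mapping.single 0 c"

lemma eval_poly_Const [simp]: "eval_poly (Const c) v = c"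
  by (simp add: Const_def monomial_value_def)

lemma eval_poly_Var [simp]: "eval_poly (Var i) v = v $ i"
proof -
  have "monomial_value (Poly_Mapping.single i 1) v = (\<Prod>j\<in>UNIV. if j = i then v $ j else 1)"
    unfolding monomial_value_def by (rule prod.cong) (auto simp: lookup_single when_def)
  then show ?thesis by (simp add: Var_def prod.delta)
qed

text \<open>Unlike \<open>total_degree\<close>, whose value at 0 is a maximum of the empty set, this
  bound holds for the zero polynomial and survives cancellation in sums.\<close>

definition degree_le :: "cpoly3 \<Rightarrow> nat \<Rightarrow> bool" where
  "degree_le f D \<longleftrightarrow> (\<forall>m\<in>Poly_Mapping.keys f. (\<Sum>i\<in>UNIV. Poly_Mapping.lookup m i) \<le> D)"

lemma degree_le_Const [simp]: "degree_le (Const c) D"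
  by (auto simp: degree_le_def Const_def keys_single)

lemma degree_le_Var: "degree_le (Var i) 1"
proof -
  have "(\<Sum>j\<in>UNIV. Poly_Mapping.lookup (Poly_Mapping.single i (1::nat)) j) = (\<Sum>j\<in>UNIV. if j = i then 1 else 0)"
    by (rule sum.cong) (auto simp: lookup_single when_def)
  then show ?thesis
    by (auto simp: degree_le_def Var_def keys_single)
qed

lemma degree_le_add: "degree_le f D \<Longrightarrow> degree_le g D \<Longrightarrow> degree_le (f + g) D"
  using Poly_Mapping.keys_add[of f g] by (force simp: degree_le_def)

lemma degree_le_sum: "(\<And>x. x \<in> A \<Longrightarrow> degree_le (f x) D) \<Longrightarrow> degree_le (\<Sum>x\<in>A. f x) D"
  by (induction A rule: infinite_finite_induct) (auto simp: degree_le_add, auto simp: degree_le_def)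

lemma degree_le_mult:
  assumes "degree_le f D" "degree_le g D'"
  shows "degree_le (f * g) (D + D')"
  unfolding degree_le_def
proof
  fix m assume "m \<in> Poly_Mapping.keys (f * g)"
  then obtain a b where "m = a + b" "a \<in> Poly_Mapping.keys f" "b \<in> Poly_Mapping.keys g"
    using keys_mult[of f g] by auto
  then show "(\<Sum>i\<in>UNIV. Poly_Mapping.lookup m i) \<le> D + D'"
    using assms by (auto simp: degree_le_def lookup_add sum.distrib intro!: add_mono)
qed

lemma degree_le_power: "degree_le f D \<Longrightarrow> degree_le (f ^ k) (k * D)"
proof (induction k)
  case 0
  then show ?case using degree_le_Const[of 1 0] by (simp add: Const_def)
next
  case (Suc k)
  then show ?case using degree_le_mult[of f D "f ^ k" "k * D"] by (simp add: algebra_simps)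
qed

lemma degree_le_total_degree: "degree_le f (total_degree f)"
  by (auto simp: degree_le_def total_degree_def intro!: Max_ge)

lemma total_degree_le: "f \<noteq> 0 \<Longrightarrow> degree_le f D \<Longrightarrow> total_degree f \<le> D"
  by (auto simp: degree_le_def total_degree_def)

text \<open>Substituting an affine function of \<open>s\<close> for each variable cannot raise the
  degree. Vanishing on a line thus becomes a matter of counting roots of \<open>p\<close>.\<close>

lemma eval_poly_on_line:
  assumes "degree_le f D"
  obtains p :: "complex poly"
    where "degree p \<le> D" "\<And>s. poly p s = eval_poly f (a + s *s b)"
proof
  define p where "p = (\<Sum>m\<in>Poly_Mapping.keys f.
    smult (Poly_Mapping.lookup f m) (\<Prod>i\<in>UNIV. [:a $ i, b $ i:] ^ Poly_Mapping.lookup m i))"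
  show "degree p \<le> D"
    unfolding p_def
  proof (rule degree_sum_le)
    fix m assume m: "m \<in> Poly_Mapping.keys f"
    have "degree (\<Prod>i\<in>UNIV. [:a $ i, b $ i:] ^ Poly_Mapping.lookup m i) \<le>
          (\<Sum>i\<in>UNIV. degree ([:a $ i, b $ i:] ^ Poly_Mapping.lookup m i))"
      using degree_prod_sum_le[of UNIV "\<lambda>i. [:a $ i, b $ i:] ^ Poly_Mapping.lookup m i"] by (simp add: o_def)
    also have "\<dots> \<le> (\<Sum>i\<in>UNIV. Poly_Mapping.lookup m i)"
      by (intro sum_mono order.trans[OF degree_power_le]) simp
    also have "\<dots> \<le> D"
      using assms m by (simp add: degree_le_def)
    finally show "degree (smult (Poly_Mapping.lookup f m) (\<Prod>i\<in>UNIV. [:a $ i, b $ i:] ^ Poly_Mapping.lookup m i)) \<le> D"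
      using degree_smult_le order.trans by blast
  qed simp
  show "poly p s = eval_poly f (a + s *s b)" for s
    by (simp add: p_def eval_poly_def poly_sum poly_prod)
qed

text \<open>The sums over equal exponents are the coefficients of a polynomial with infinitely many
  roots. As \<open>e\<close> need not be injective, one variable out of several can be peeled
  off.\<close>

lemma sum_powers_vanish_on_infinite:
  fixes g :: "'s \<Rightarrow> complex"
  assumes "finite S" "infinite A" and vanish: "\<And>x. x \<in> A \<Longrightarrow> (\<Sum>s\<in>S. g s * x ^ e s) = 0"
  shows "(\<Sum>s\<in>{s\<in>S. e s = k}. g s) = 0"
proof -
  define p where "p = (\<Sum>s\<in>S. monom (g s) (e s))"
  have "A \<subseteq> {x. poly p x = 0}"
    using vanish by (auto simp: p_def poly_sum poly_monom)
  then have "p = 0"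
    using poly_roots_finite[of p] assms(2) finite_subset by blast
  then have "0 = coeff p k" by simp
  also have "\<dots> = (\<Sum>s\<in>S. if e s = k then g s else 0)"
    by (simp add: p_def coeff_sum)
  also have "\<dots> = (\<Sum>s\<in>{s\<in>S. e s = k}. g s)"
    using assms(1) by (simp add: sum.inter_filter)
  finally show ?thesis by simp
qed

text \<open>The variables are peeled off in turn: \<open>S1\<close>, \<open>S2\<close>,
  \<open>S3\<close> collect the monomials agreeing with \<open>m\<close> in the first one, two and
  three exponents, so \<open>S3\<close> contains at most \<open>m\<close>.\<close>

lemma eval_poly_vanish_imp_zero:
  assumes "infinite A"
    and vanish: "\<And>x y z. x \<in> A \<Longrightarrow> y \<in> A \<Longrightarrow> z \<in> A \<Longrightarrow> eval_poly f (vector [x, y, z]) = 0"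
  shows "f = 0"
proof (rule poly_mapping_eqI)
  fix m :: "3 \<Rightarrow>\<^sub>0 nat"
  define S1 where "S1 = {s \<in> Poly_Mapping.keys f. Poly_Mapping.lookup s 1 = Poly_Mapping.lookup m 1}"
  define S2 where "S2 = {s \<in> S1. Poly_Mapping.lookup s 2 = Poly_Mapping.lookup m 2}"
  define S3 where "S3 = {s \<in> S2. Poly_Mapping.lookup s 3 = Poly_Mapping.lookup m 3}"
  have fin: "finite S1" "finite S2"
    unfolding S1_def S2_def by simp_all
  have 0: "(\<Sum>s\<in>Poly_Mapping.keys f.
      (Poly_Mapping.lookup f s * y ^ Poly_Mapping.lookup s 2 * z ^ Poly_Mapping.lookup s 3) * x ^ Poly_Mapping.lookup s 1) = 0"
    if "x \<in> A" "y \<in> A" "z \<in> A" for x y z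
    using vanish[OF that] by (simp add: eval_poly_def prod_UNIV_3 mult_ac)
  have 1: "(\<Sum>s\<in>S1. Poly_Mapping.lookup f s * z ^ Poly_Mapping.lookup s 3 * y ^ Poly_Mapping.lookup s 2) = 0"
    if "y \<in> A" "z \<in> A" for y z
    using sum_powers_vanish_on_infinite[OF finite_keys assms(1) 0[OF _ that]]
    by (simp add: S1_def mult_ac)
  have 2: "(\<Sum>s\<in>S2. Poly_Mapping.lookup f s * z ^ Poly_Mapping.lookup s 3) = 0" if "z \<in> A" for z
    using sum_powers_vanish_on_infinite[OF fin(1) assms(1) 1[OF _ that]] by (simp add: S2_def)
  have 3: "(\<Sum>s\<in>S3. Poly_Mapping.lookup f s) = 0"
    using sum_powers_vanish_on_infinite[OF fin(2) assms(1) 2] by (simp add: S3_def)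
  have eq: "s = m" if "Poly_Mapping.lookup s 1 = Poly_Mapping.lookup m 1"
    "Poly_Mapping.lookup s 2 = Poly_Mapping.lookup m 2"
    "Poly_Mapping.lookup s 3 = Poly_Mapping.lookup m 3" for s
    by (rule poly_mapping_eqI) (use that exhaust_3 in metis)
  have "S3 = (if m \<in> Poly_Mapping.keys f then {m} else {})"
    using eq by (auto simp: S1_def S2_def S3_def)
  with 3 show "Poly_Mapping.lookup f m = Poly_Mapping.lookup 0 m"
    by (auto simp: in_keys_iff split: if_splits)
qed

section \<open>Counting invariants against linear conditions\<close>

text \<open>Gaussian elimination: a pivot \<open>s\<close> in row \<open>r\<close> removes one
  equation and one unknown, while a zero row constrains nothing.\<close>

lemma underdetermined_system:
  fixes M :: "'r \<Rightarrow> 't \<Rightarrow> 'a :: field"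
  assumes "finite R" "finite T" "card R < card T"
  shows "\<exists>c. (\<exists>t\<in>T. c t \<noteq> 0) \<and> (\<forall>r\<in>R. (\<Sum>t\<in>T. M r t * c t) = 0)"
  using assms
proof (induction R arbitrary: T M rule: finite_induct)
  case empty
  then have "T \<noteq> {}" by auto
  then show ?case by (intro exI[of _ "\<lambda>_. 1"]) auto
next
  case (insert r R)
  show ?case
  proof (cases "\<forall>t\<in>T. M r t = 0")
    case True
    obtain c where "\<exists>t\<in>T. c t \<noteq> 0" "\<forall>r\<in>R. (\<Sum>t\<in>T. M r t * c t) = 0"
      using insert.IH[of T M] insert.prems insert.hyps by auto
    with True show ?thesis by auto
  next
    case False
    then obtain s where s: "s \<in> T" "M r s \<noteq> 0" by auto
    define T' where "T' = T - {s}"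
    have T: "T = insert s T'" "s \<notin> T'" "finite T'"
      using s insert.prems by (auto simp: T'_def)
    have "card R < card T'"
      using insert.prems insert.hyps T by simp
    then obtain c where c: "\<exists>t\<in>T'. c t \<noteq> 0"
      "\<forall>q\<in>R. (\<Sum>t\<in>T'. (M q t - M q s * M r t / M r s) * c t) = 0"
      using insert.IH[of T' "\<lambda>q t. M q t - M q s * M r t / M r s"] T by auto
    define S where "S q = (\<Sum>t\<in>T'. M q t * c t)" for q
    \<comment> \<open>Row \<open>r\<close> forces this value of the pivot unknown.\<close>
    define c' where "c' = c(s := - S r / M r s)"
    have S': "(\<Sum>t\<in>T'. M q t * c' t) = S q" for q
      unfolding S_def by (rule sum.cong) (use T in \<open>auto simp: c'_def\<close>)
    have "S q - M q s * S r / M r s = 0" if "q \<in> R" for q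
    proof -
      have "M q s * S r / M r s = (\<Sum>t\<in>T'. M q s * M r t / M r s * c t)"
        by (simp add: S_def sum_distrib_left sum_divide_distrib mult_ac)
      then show ?thesis
        using c(2) that by (simp add: S_def left_diff_distrib sum_subtractf)
    qed
    then have "\<forall>q\<in>insert r R. (\<Sum>t\<in>T. M q t * c' t) = 0"
      using s T by (auto simp: S') (auto simp: c'_def field_simps)
    moreover have "\<exists>t\<in>T. c' t \<noteq> 0"
      using c(1) T by (auto simp: c'_def)
    ultimately show ?thesis by blast
  qed
qed

text \<open>The pairs \<open>(b, c)\<close> index the dihedral invariants \<open>z\<^sup>a (x\<^sup>2 + y\<^sup>2)\<^sup>b (x\<^sup>3 - 3xy\<^sup>2)\<^sup>c\<close> of degree \<open>d\<close>.\<close>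

definition weighted_exponents :: "nat \<Rightarrow> (nat \<times> nat) set" where
  "weighted_exponents d = {(b, c). 2 * b + 3 * c \<le> d}"

lemma finite_weighted_exponents: "finite (weighted_exponents d)"
  by (rule finite_subset[of _ "{..d} \<times> {..d}"]) (auto simp: weighted_exponents_def)

text \<open>Shifting \<open>c\<close> by 2 embeds the pairs for \<open>d\<close>. The remaining
  pairs have \<open>c = 0\<close> or \<open>c = 1\<close>; as \<open>d + 6\<close> and
  \<open>d + 3\<close> differ in parity, their number is exactly \<open>d + 6\<close>.\<close>

lemma card_weighted_exponents_add_6:
  "card (weighted_exponents (d + 6)) = card (weighted_exponents d) + d + 6"
proof -
  let ?sh = "\<lambda>(b, c). (b :: nat, c + 2 :: nat)"
  let ?B = "(\<lambda>b. (b, 0 :: nat)) ` {..(d + 6) div 2}" and ?C = "(\<lambda>b. (b, 1 :: nat)) ` {..(d + 3) div 2}"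
  have eq: "weighted_exponents (d + 6) = ?sh ` weighted_exponents d \<union> (?B \<union> ?C)"
  proof (intro equalityI subsetI)
    fix x assume x: "x \<in> weighted_exponents (d + 6)"
    obtain b c where bc: "x = (b, c)" by (cases x)
    consider "c = 0" | "c = 1" | c' where "c = c' + 2"
      by (metis One_nat_def add_2_eq_Suc' not0_implies_Suc)
    then show "x \<in> ?sh ` weighted_exponents d \<union> (?B \<union> ?C)"
      using x bc by cases (auto simp: weighted_exponents_def image_iff)
  qed (auto simp: weighted_exponents_def)
  have "card (?sh ` weighted_exponents d) = card (weighted_exponents d)"
    by (rule card_image) (auto simp: inj_on_def)
  moreover have "card ?B = (d + 6) div 2 + 1" "card ?C = (d + 3) div 2 + 1"
    by (subst card_image; auto simp: inj_on_def)+
  moreover have "card (?B \<union> ?C) = card ?B + card ?C"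
    by (rule card_Un_disjoint) auto
  moreover have "card (weighted_exponents (d + 6)) = card (?sh ` weighted_exponents d) + card (?B \<union> ?C)"
    unfolding eq by (rule card_Un_disjoint) (auto simp: finite_weighted_exponents)
  ultimately show ?thesis by presburger
qed

text \<open>The quadratic also grows by exactly \<open>d + 6\<close> from \<open>d\<close> to
  \<open>d + 6\<close>, so only the degrees below 6 need explicit pairs.\<close>

lemma card_weighted_exponents_gt:
  "real (card (weighted_exponents d)) > (real d)^2 / 12 + real d / 2"
proof (induction d rule: less_induct)
  case (less d)
  show ?case
  proof (cases "d < 6")
    case True
    have sub: "card S \<le> card (weighted_exponents d)" if "S \<subseteq> weighted_exponents d" for S
      by (rule card_mono[OF finite_weighted_exponents that])
    consider "d = 0" | "d = 1" | "d = 2" | "d = 3" | "d = 4" | "d = 5"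
      using True by linarith
    then show ?thesis
    proof cases
      case 1 then show ?thesis using sub[of "{(0,0)}"] by (simp add: weighted_exponents_def)
    next
      case 2 then show ?thesis using sub[of "{(0,0)}"] by (simp add: weighted_exponents_def)
    next
      case 3 then show ?thesis using sub[of "{(0,0),(1,0)}"] by (simp add: weighted_exponents_def)
    next
      case 4 then show ?thesis using sub[of "{(0,0),(1,0),(0,1)}"] by (simp add: weighted_exponents_def)
    next
      case 5 then show ?thesis using sub[of "{(0,0),(1,0),(0,1),(2,0)}"] by (simp add: weighted_exponents_def)
    next
      case 6 then show ?thesis using sub[of "{(0,0),(1,0),(0,1),(2,0),(1,1)}"] by (simp add: weighted_exponents_def)
    qed
  next
    case False
    then obtain e where e: "d = e + 6" by (metis add.commute le_Suc_ex not_less)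
    have "real (card (weighted_exponents e)) > (real e)^2 / 12 + real e / 2"
      using less.IH[of e] e by simp
    then show ?thesis
      unfolding e card_weighted_exponents_add_6 by (simp add: power2_eq_square field_simps)
  qed
qed

section \<open>Triple points as sums of roots of unity\<close>

text \<open>With integer exponents, inverses and conjugates are values of \<open>zeta\<close>
  too.\<close>

definition zeta :: "nat \<Rightarrow> int \<Rightarrow> complex" where
  "zeta n k = cis (2 * pi * real_of_int k / real n)"

lemma zeta_add: "zeta n (a + b) = zeta n a * zeta n b"
  by (simp add: zeta_def cis_mult add_divide_distrib distrib_left)

lemma cnj_zeta: "cnj (zeta n a) = zeta n (- a)"
  by (simp add: zeta_def cis_cnj)

lemma zeta_nonzero [simp]: "zeta n a \<noteq> 0"
  by (simp add: zeta_def)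

lemma zeta_0 [simp]: "zeta n 0 = 1"
  by (simp add: zeta_def)

lemma zeta_eq_1_iff:
  assumes "n > 0"
  shows "zeta n a = 1 \<longleftrightarrow> int n dvd a"
proof
  assume "zeta n a = 1"
  then have "cos (2 * pi * real_of_int a / real n) = 1"
    by (simp add: zeta_def complex_eq_iff)
  then obtain k :: int where "2 * pi * real_of_int a / real n = of_int k * 2 * pi"
    using cos_one_2pi_int by auto
  then have "real_of_int a = real_of_int (int n * k)"
    using assms by (simp add: field_simps)
  then show "int n dvd a"
    by (metis dvd_triv_left of_int_eq_iff)
next
  assume "int n dvd a"
  then obtain k where a: "a = int n * k" by auto
  have "2 * pi * real_of_int a / real n = 2 * pi * real_of_int k"
    using assms by (simp add: a)
  then show "zeta n a = 1"
    by (simp add: zeta_def complex_eq_iff)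
qed

lemma zeta_eq_iff:
  assumes "n > 0"
  shows "zeta n a = zeta n b \<longleftrightarrow> int n dvd a - b"
proof -
  have "zeta n a = zeta n (a - b) * zeta n b"
    by (simp add: zeta_add[symmetric])
  then have "zeta n a = zeta n b \<longleftrightarrow> zeta n (a - b) = 1" by simp
  then show ?thesis by (simp add: zeta_eq_1_iff[OF assms])
qed

lemma zeta_nat_inj:
  assumes "n > 0" "i < n" "j < n" "zeta n (int i) = zeta n (int j)"
  shows "i = j"
proof -
  have "int n dvd int i - int j"
    using assms zeta_eq_iff by blast
  then have "int n dvd \<bar>int i - int j\<bar>" by simp
  then have "\<bar>int i - int j\<bar> = 0"
    using assms(2,3) zdvd_not_zless[of "\<bar>int i - int j\<bar>" "int n"] by linarith
  then show ?thesis by simp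
qed

section \<open>Real and complex equations of the lines\<close>

definition plane_complex :: "real ^ 2 \<Rightarrow> complex" where
  "plane_complex p = Complex (p $ 1) (p $ 2)"

lemma plane_complex_inj: "plane_complex p = plane_complex q \<Longrightarrow> p = q"
  by (simp add: plane_complex_def vec_eq_iff forall_2)

lemma mem_affine_hull_unit_normal:
  fixes a b p N :: "real ^ 2"
  assumes "(N $ 1)^2 + (N $ 2)^2 = 1" "a \<noteq> b"
    and a: "a $ 1 * N $ 1 + a $ 2 * N $ 2 = c" and b: "b $ 1 * N $ 1 + b $ 2 * N $ 2 = c"
  shows "p \<in> affine hull {a, b} \<longleftrightarrow> p $ 1 * N $ 1 + p $ 2 * N $ 2 = c"
proof
  assume "p \<in> affine hull {a, b}"
  then obtain u v where p: "p = u *\<^sub>R a + v *\<^sub>R b" and uv: "u + v = 1"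
    by (auto simp: affine_hull_2)
  have "p $ 1 * N $ 1 + p $ 2 * N $ 2 =
        u * (a $ 1 * N $ 1 + a $ 2 * N $ 2) + v * (b $ 1 * N $ 1 + b $ 2 * N $ 2)"
    by (simp add: p algebra_simps)
  also have "\<dots> = (u + v) * c" unfolding a b by (simp add: algebra_simps)
  finally show "p $ 1 * N $ 1 + p $ 2 * N $ 2 = c" by (simp add: uv)
next
  assume p: "p $ 1 * N $ 1 + p $ 2 * N $ 2 = c"
  \<comment> \<open>\<open>T\<close> is the coordinate along the line. By \<open>rec\<close> it
    determines a point of the line affinely, so interpolating \<open>T\<close> interpolates the
    points.\<close>
  define T where "T q = q $ 1 * N $ 2 - q $ 2 * N $ 1" for q :: "real ^ 2"
  have rec: "q $ 1 = c * N $ 1 + T q * N $ 2 \<and> q $ 2 = c * N $ 2 - T q * N $ 1"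
    if "q $ 1 * N $ 1 + q $ 2 * N $ 2 = c" for q
  proof -
    have "q $ 1 = q $ 1 * ((N $ 1)^2 + (N $ 2)^2)" "q $ 2 = q $ 2 * ((N $ 1)^2 + (N $ 2)^2)"
      using assms(1) by simp_all
    then show ?thesis
      unfolding T_def that[symmetric] by (auto simp: power2_eq_square algebra_simps)
  qed
  have ab: "T b - T a \<noteq> 0"
  proof
    assume "T b - T a = 0"
    then have "a = b" using rec[OF a] rec[OF b] by (simp add: vec_eq_iff forall_2)
    with \<open>a \<noteq> b\<close> show False by simp
  qed
  define s where "s = (T p - T a) / (T b - T a)"
  have "s * (T b - T a) = T p - T a"
    using ab by (simp add: s_def)
  then have "T p = (1 - s) * T a + s * T b"
    by (simp add: algebra_simps)
  then have "p $ 1 = (1 - s) * a $ 1 + s * b $ 1" "p $ 2 = (1 - s) * a $ 2 + s * b $ 2"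
    using rec[OF a, THEN conjunct1] rec[OF b, THEN conjunct1] rec[OF p, THEN conjunct1]
      rec[OF a, THEN conjunct2] rec[OF b, THEN conjunct2] rec[OF p, THEN conjunct2] by algebra+
  then have "p = (1 - s) *\<^sub>R a + s *\<^sub>R b"
    by (simp add: vec_eq_iff forall_2)
  then show "p \<in> affine hull {a, b}"
    unfolding affine_hull_2 by (intro CollectI exI[of _ "1 - s"] exI[of _ s]) simp
qed

text \<open>The angles \<open>2 * t\<close> and \<open>pi - 4 * t\<close> have mean
  \<open>pi / 2 - t\<close>, so the chord has unit normal \<open>(sin t, cos t)\<close>. If the
  points coincide, this normal is parallel to the radius, and the tangent has the same
  equation.\<close>

lemma mem_boroczky_line_iff:
  fixes n j :: nat
  assumes "n > 0"
  defines "t \<equiv> pi * real j / real n"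
  shows "p \<in> boroczky_line n j \<longleftrightarrow> p $ 1 * sin t + p $ 2 * cos t = sin (3 * t)"
proof -
  define N :: "real ^ 2" where "N = vector [sin t, cos t]"
  define a where "a = circle_point (2 * t)"
  define b where "b = circle_point (pi - 4 * t)"
  have ang: "2 * pi * real j / real n = 2 * t" "pi - 4 * pi * real j / real n = pi - 4 * t"
    by (simp_all add: t_def)
  have N: "N $ 1 = sin t" "N $ 2 = cos t" by (simp_all add: N_def)
  have ac: "a $ 1 = cos (2 * t)" "a $ 2 = sin (2 * t)" by (simp_all add: a_def circle_point_def)
  have bc: "b $ 1 = - cos (4 * t)" "b $ 2 = sin (4 * t)" by (simp_all add: b_def circle_point_def)
  have a: "a $ 1 * N $ 1 + a $ 2 * N $ 2 = sin (3 * t)"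
    using sin_add[of "2 * t" t] by (simp add: ac N)
  have b: "b $ 1 * N $ 1 + b $ 2 * N $ 2 = sin (3 * t)"
    using sin_diff[of "4 * t" t] by (simp add: bc N)
  show ?thesis
  proof (cases "a = b")
    case False
    then have "boroczky_line n j = affine hull {a, b}"
      by (simp add: boroczky_line_def Let_def ang a_def b_def)
    then show ?thesis
      using mem_affine_hull_unit_normal[OF _ False a b, of p] by (simp add: N)
  next
    case True
    define c where "c = a + vector [- sin (2 * t), cos (2 * t)]"
    have cc: "c $ 1 = cos (2 * t) - sin (2 * t)" "c $ 2 = sin (2 * t) + cos (2 * t)"
      by (simp_all add: c_def ac)
    have "cos (2 * t) = - cos (4 * t)" "sin (2 * t) = sin (4 * t)"
      using True ac bc by auto
    moreover have "cos (3 * t) = cos (2 * t) * cos t - sin (2 * t) * sin t"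
      using cos_add[of "2 * t" t] by simp
    moreover have "cos (3 * t) = cos (4 * t) * cos t + sin (4 * t) * sin t"
      using cos_diff[of "4 * t" t] by simp
    \<comment> \<open>The two expansions of \<open>cos (3 * t)\<close> are now negatives of each
      other. Their vanishing says that the tangent direction is orthogonal to
      \<open>N\<close>.\<close>
    ultimately have "cos (2 * t) * cos t - sin (2 * t) * sin t = 0" by algebra
    then have c: "c $ 1 * N $ 1 + c $ 2 * N $ 2 = sin (3 * t)"
      using a by (simp add: cc ac N algebra_simps)
    have ne: "a \<noteq> c"
    proof
      assume "a = c"
      then have "sin (2 * t) = 0" "cos (2 * t) = 0" using ac cc by auto
      then show False using sin_cos_squared_add[of "2 * t"] by simp
    qed
    have "boroczky_line n j = circle_tangent (2 * t)"
      using True by (simp add: boroczky_line_def Let_def ang a_def b_def)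
    also have "\<dots> = affine hull {a, c}"
      unfolding affine_hull_2_alt circle_tangent_def c_def a_def by auto
    finally show ?thesis
      using mem_affine_hull_unit_normal[OF _ ne a c, of p] by (simp add: N)
  qed
qed

text \<open>Multiplying the line equation by \<open>2\<i> e\<^sup>3\<^sup>i\<^sup>t\<close> turns it into a cubic in \<open>e\<^sup>2\<^sup>i\<^sup>t\<close>.\<close>

lemma mem_boroczky_line_iff_cubic:
  fixes n j :: nat
  assumes "n > 0"
  defines "E \<equiv> zeta n (int j)"
  shows "p \<in> boroczky_line n j \<longleftrightarrow> E ^ 3 - plane_complex p * E ^ 2 + cnj (plane_complex p) * E - 1 = 0"
proof -
  define t where "t = pi * real j / real n"
  define e where "e = cis t"
  have E: "E = e ^ 2"
    by (simp add: E_def zeta_def e_def t_def power2_eq_square cis_mult field_simps)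
  define u where "u = plane_complex p"
  have "e * cnj e = 1" by (simp add: e_def cis_cnj cis_mult)
  define r where "r = p $ 1 * sin t + p $ 2 * cos t - sin (3 * t)"
  have e3: "e ^ 3 = cis (3 * t)" "cnj e ^ 3 = cis (- (3 * t))"
    using Complex.DeMoivre[of t 3] Complex.DeMoivre[of "- t" 3] by (simp_all add: e_def cis_cnj)
  \<comment> \<open>The left side is \<open>w - cnj w\<close> for \<open>w = e * u - e ^ 3\<close>,
    and \<open>r\<close> is the imaginary part of \<open>w\<close>.\<close>
  have A: "e * u - cnj e * cnj u - e ^ 3 + cnj e ^ 3 = 2 * \<i> * of_real r"
    by (simp add: e3 complex_eq_iff u_def plane_complex_def r_def) (simp add: e_def algebra_simps)
  have "E ^ 3 - u * E ^ 2 + cnj u * E - 1 = - (e ^ 3) * (e * u - cnj e * cnj u - e ^ 3 + cnj e ^ 3)"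
  proof -
    have "- (e ^ 3) * (e * u - cnj e * cnj u - e ^ 3 + cnj e ^ 3) =
        (e^2) ^ 3 - u * (e^2)^2 + cnj u * e^2 * (e * cnj e) - (e * cnj e) ^ 3"
      by (simp add: power_mult_distrib eval_nat_numeral algebra_simps)
    then show ?thesis unfolding E \<open>e * cnj e = 1\<close> by simp
  qed
  then have "E ^ 3 - u * E ^ 2 + cnj u * E - 1 = 0 \<longleftrightarrow> r = 0"
    unfolding A by (simp add: e_def)
  then show ?thesis
    using mem_boroczky_line_iff[OF assms(1), of p j] by (simp add: u_def r_def t_def)
qed

text \<open>Eliminating \<open>v\<close> leaves a multiple of \<open>x - y\<close>. For nonzero
  \<open>x\<close> and \<open>y\<close> the result determines \<open>u\<close>, so it locates the
  intersection of two lines.\<close>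

lemma cubic_two_roots:
  fixes x y u v :: complex
  assumes "x ^ 3 - u * x ^ 2 + v * x - 1 = 0" "y ^ 3 - u * y ^ 2 + v * y - 1 = 0" "x \<noteq> y"
  shows "u * x * y = x ^ 2 * y + x * y ^ 2 + 1"
proof -
  have "(x - y) * (u * x * y - (x ^ 2 * y + x * y ^ 2 + 1)) = 0"
    using assms(1,2) by algebra
  then show ?thesis using assms(3) by simp
qed

text \<open>Two of Vieta's formulas, obtained by comparing the values of \<open>u\<close> given by
  two pairs of roots.\<close>

lemma cubic_three_roots:
  fixes x y z u v :: complex
  assumes "x ^ 3 - u * x ^ 2 + v * x - 1 = 0" "y ^ 3 - u * y ^ 2 + v * y - 1 = 0"
    "z ^ 3 - u * z ^ 2 + v * z - 1 = 0" "x \<noteq> y" "x \<noteq> z" "y \<noteq> z"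
  shows "u = x + y + z" "x * y * z = 1"
proof -
  have "x \<noteq> 0" using assms(1) by auto
  have "x * (y - z) * (u - (x + y + z)) = 0"
    using cubic_two_roots[OF assms(1,2,4)] cubic_two_roots[OF assms(1,3,5)] by algebra
  then show u: "u = x + y + z" using \<open>x \<noteq> 0\<close> assms(6) by simp
  show "x * y * z = 1"
    using cubic_two_roots[OF assms(1,2,4)] unfolding u by algebra
qed

lemma boroczky_lines_meet_once:
  assumes "n > 0" "i < n" "j < n" "i \<noteq> j"
    and "p \<in> boroczky_line n i" "p \<in> boroczky_line n j" "q \<in> boroczky_line n i" "q \<in> boroczky_line n j"
  shows "p = q"
proof -
  have ne: "zeta n (int i) \<noteq> zeta n (int j)"
    using assms zeta_nat_inj by blast
  have "plane_complex r * zeta n (int i) * zeta n (int j) =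
      zeta n (int i) ^ 2 * zeta n (int j) + zeta n (int i) * zeta n (int j) ^ 2 + 1"
    if "r \<in> boroczky_line n i" "r \<in> boroczky_line n j" for r
    using that cubic_two_roots[OF _ _ ne] by (simp add: mem_boroczky_line_iff_cubic[OF assms(1)])
  from this[OF assms(5,6)] this[OF assms(7,8)] have
    "plane_complex p * (zeta n (int i) * zeta n (int j)) = plane_complex q * (zeta n (int i) * zeta n (int j))"
    by (simp add: mult.assoc)
  then show ?thesis by (simp add: plane_complex_inj)
qed

text \<open>The foot of the perpendicular from the origin, \<open>sin (3 * t)\<close> times the unit
  normal, plus \<open>s\<close> times the unit direction \<open>(cos t, - sin t)\<close>.\<close>

definition line_param :: "real \<Rightarrow> real \<Rightarrow> real ^ 2" where
  "line_param t s = vector [s * cos t + sin (3 * t) * sin t, sin (3 * t) * cos t - s * sin t]"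

lemma mem_boroczky_line_iff_param:
  assumes "n > 0"
  shows "p \<in> boroczky_line n j \<longleftrightarrow> (\<exists>s. p = line_param (pi * real j / real n) s)"
proof -
  define t where "t = pi * real j / real n"
  have sc: "sin t * sin t + cos t * cos t = 1"
    using sin_cos_squared_add[of t] by (simp add: power2_eq_square)
  have "p $ 1 * sin t + p $ 2 * cos t = sin (3 * t) \<longleftrightarrow> (\<exists>s. p = line_param t s)"
  proof
    assume e: "p $ 1 * sin t + p $ 2 * cos t = sin (3 * t)"
    have "p $ 1 = (p $ 1 * cos t - p $ 2 * sin t) * cos t + (p $ 1 * sin t + p $ 2 * cos t) * sin t"
      "p $ 2 = (p $ 1 * sin t + p $ 2 * cos t) * cos t - (p $ 1 * cos t - p $ 2 * sin t) * sin t"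
      using sc by algebra+
    then have "p = line_param t (p $ 1 * cos t - p $ 2 * sin t)"
      unfolding e by (simp add: vec_eq_iff forall_2 line_param_def)
    then show "\<exists>s. p = line_param t s" ..
  next
    assume "\<exists>s. p = line_param t s"
    then obtain s where p: "p = line_param t s" ..
    show "p $ 1 * sin t + p $ 2 * cos t = sin (3 * t)"
      unfolding p line_param_def vector_2 using sc by algebra
  qed
  then show ?thesis
    using mem_boroczky_line_iff[OF assms, of p j] by (simp add: t_def)
qed

lemma line_param_inj: "line_param t s = line_param t s' \<Longrightarrow> s = s'"
proof -
  assume "line_param t s = line_param t s'"
  then have "s * cos t = s' * cos t" "s * sin t = s' * sin t"
    by (auto simp: line_param_def vec_eq_iff forall_2)
  then have "s * ((sin t)\<^sup>2 + (cos t)\<^sup>2) = s' * ((sin t)\<^sup>2 + (cos t)\<^sup>2)"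
    by algebra
  then show ?thesis by simp
qed

text \<open>Distinct indices share at most one point, but a line has two. Hence counting lines as
  sets, as \<open>triple_points\<close> does, amounts to counting indices.\<close>

lemma inj_on_boroczky_line:
  assumes "n > 0"
  shows "inj_on (boroczky_line n) {..<n}"
proof (rule inj_onI, rule ccontr)
  fix i j assume ij: "i \<in> {..<n}" "j \<in> {..<n}" "boroczky_line n i = boroczky_line n j" "i \<noteq> j"
  let ?p = "line_param (pi * real i / real n)"
  have "?p s \<in> boroczky_line n i" "?p s \<in> boroczky_line n j" for s
    unfolding ij(3)[symmetric] using mem_boroczky_line_iff_param[OF assms] by blast+
  then have "?p 0 = ?p 1"
    using boroczky_lines_meet_once[OF assms, of i j "?p 0" "?p 1"] ij by simp
  then show False using line_param_inj by force
qed

section \<open>Triple points as triples of indices\<close>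

lemma boroczky_lines_eq:
  assumes "n > 0"
  shows "boroczky_lines n = boroczky_line n ` {..<n}"
proof -
  have "{0..n - 1} = {..<n}" using assms by auto
  then show ?thesis by (simp add: boroczky_lines_def)
qed

lemma triple_point_imp_roots_of_unity:
  assumes "n > 0" "p \<in> triple_points n"
  obtains i j k where "i < n" "j < n" "k < n" "i \<noteq> j" "i \<noteq> k" "j \<noteq> k" "n dvd i + j + k"
    "plane_complex p = zeta n (int i) + zeta n (int j) + zeta n (int k)"
proof -
  obtain l1 l2 l3 where l: "{l \<in> boroczky_lines n. p \<in> l} = {l1, l2, l3}" "l1 \<noteq> l2" "l1 \<noteq> l3" "l2 \<noteq> l3"
    using assms(2) by (auto simp: triple_points_def card_3_iff)
  have "\<exists>i<n. l = boroczky_line n i \<and> p \<in> boroczky_line n i" if "l \<in> {l1, l2, l3}" for l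
    using that unfolding l(1)[symmetric] boroczky_lines_eq[OF assms(1)] by auto
  then obtain i j k where ijk: "i < n" "j < n" "k < n"
    "l1 = boroczky_line n i" "l2 = boroczky_line n j" "l3 = boroczky_line n k"
    "p \<in> boroczky_line n i" "p \<in> boroczky_line n j" "p \<in> boroczky_line n k"
    by (metis insertI1 insertI2)
  have ne: "i \<noteq> j" "i \<noteq> k" "j \<noteq> k" using l ijk by auto
  then have zne: "zeta n (int i) \<noteq> zeta n (int j)" "zeta n (int i) \<noteq> zeta n (int k)"
    "zeta n (int j) \<noteq> zeta n (int k)"
    using zeta_nat_inj[OF assms(1)] ijk by blast+
  note roots = ijk(7-9)[unfolded mem_boroczky_line_iff_cubic[OF assms(1)]]
  have "zeta n (int i + int j + int k) = 1"
    using cubic_three_roots(2)[OF roots zne] by (simp add: zeta_add)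
  then have "int n dvd int (i + j + k)"
    using zeta_eq_1_iff[OF assms(1)] by simp
  then have "n dvd i + j + k" by (simp only: int_dvd_int_iff)
  with ijk(1-3) ne show ?thesis
    using cubic_three_roots(1)[OF roots zne] that by blast
qed

text \<open>Conjugation inverts points of the unit circle, so a product 1 gives
  \<open>cnj x = y * z\<close> and its analogues. This matches the linear coefficient of the cubic
  with the second symmetric function.\<close>

lemma cnj_sum_zeta:
  fixes n :: nat and i j k :: int
  assumes "n > 0" "int n dvd i + j + k"
  defines "x \<equiv> zeta n i" and "y \<equiv> zeta n j" and "z \<equiv> zeta n k"
  shows "x * y * z = 1" "cnj (x + y + z) = x * y + x * z + y * z"
proof -
  show xyz: "x * y * z = 1"
    using zeta_eq_1_iff[OF assms(1), of "i + j + k"] assms by (simp add: zeta_add)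
  have "zeta n a * cnj (zeta n a) = 1" for a
    by (simp add: cnj_zeta zeta_add[symmetric])
  then have "x * cnj x = 1" "y * cnj y = 1" "z * cnj z = 1"
    by (simp_all add: x_def y_def z_def)
  then have "cnj x = y * z" "cnj y = x * z" "cnj z = x * y"
    using xyz by algebra+
  then show "cnj (x + y + z) = x * y + x * z + y * z"
    by (simp add: algebra_simps)
qed

text \<open>By \<open>cnj_sum_zeta\<close> the cubic of \<open>p\<close> splits into the linear
  factors belonging to \<open>i\<close>, \<open>j\<close>, \<open>k\<close>.\<close>

lemma triple_point_mem_line_iff:
  assumes "n > 0" "i < n" "j < n" "k < n" "n dvd i + j + k" "l < n"
    and p: "plane_complex p = zeta n (int i) + zeta n (int j) + zeta n (int k)"
  shows "p \<in> boroczky_line n l \<longleftrightarrow> l \<in> {i, j, k}"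
proof -
  let ?x = "zeta n (int i)" and ?y = "zeta n (int j)" and ?z = "zeta n (int k)" and ?E = "zeta n (int l)"
  have "int n dvd int i + int j + int k"
    using assms(5) by (metis int_dvd_int_iff of_nat_add)
  note s = cnj_sum_zeta[OF assms(1) this]
  have "?E ^ 3 - plane_complex p * ?E ^ 2 + cnj (plane_complex p) * ?E - 1 = (?E - ?x) * (?E - ?y) * (?E - ?z)"
    unfolding p s(2) using s(1) by algebra
  then have "p \<in> boroczky_line n l \<longleftrightarrow> ?E = ?x \<or> ?E = ?y \<or> ?E = ?z"
    by (simp add: mem_boroczky_line_iff_cubic[OF assms(1)])
  also have "\<dots> \<longleftrightarrow> l \<in> {i, j, k}"
    using assms zeta_nat_inj[OF assms(1)] by blast
  finally show ?thesis .
qed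

lemma roots_of_unity_imp_triple_point:
  assumes "n > 0" "i < n" "j < n" "k < n" "i \<noteq> j" "i \<noteq> k" "j \<noteq> k" "n dvd i + j + k"
    and p: "plane_complex p = zeta n (int i) + zeta n (int j) + zeta n (int k)"
  shows "p \<in> triple_points n"
proof -
  have "{l \<in> boroczky_lines n. p \<in> l} = boroczky_line n ` {i, j, k}"
    using triple_point_mem_line_iff[OF assms(1-4,8) _ p] assms(2-4)
    unfolding boroczky_lines_eq[OF assms(1)] by auto
  moreover have "card (boroczky_line n ` {i, j, k}) = card {i, j, k}"
    by (intro card_image inj_on_subset[OF inj_on_boroczky_line[OF assms(1)]]) (use assms in auto)
  ultimately show ?thesis using assms(5-7) by (simp add: triple_points_def)
qed

text \<open>All scalar multiples must be kept, since \<open>f\<close> is not assumed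
  homogeneous.\<close>

lemma mem_boroczky_ideal_iff:
  "f \<in> boroczky_ideal n \<longleftrightarrow> (\<forall>p\<in>triple_points n. \<forall>c. c \<noteq> 0 \<longrightarrow>
     eval_poly f (c *s vector [complex_of_real (p $ 1), complex_of_real (p $ 2), 1]) = 0)"
proof -
  have "embed_proj p = {c *s vector [complex_of_real (p $ 1), complex_of_real (p $ 2), 1] | c. c \<noteq> 0}" for p
  proof -
    have "(c *s vector [complex_of_real (p $ 1), complex_of_real (p $ 2), 1] :: complex ^ 3) \<noteq> 0" if "c \<noteq> 0" for c
      using that by (simp add: vec_eq_iff forall_3)
    from this[of 1] this show ?thesis
      by (auto simp: embed_proj_def proj_rel_def)
  qed
  then show ?thesis
    by (auto simp: boroczky_ideal_def vanishing_ideal_def boroczky_points_def) blast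
qed

section \<open>The lower bound\<close>

text \<open>
  For even \<open>n\<close>, a triple point of an odd line \<open>L\<^sub>j\<close> lies on exactly one line \<open>L\<^sub>i\<close> with \<open>i\<close> even, so the
  even indices number the triple points of \<open>L\<^sub>j\<close>; only \<open>i \<equiv> -2j\<close> drops out, as the third line would be
  \<open>L\<^sub>j\<close> again.
\<close>

lemma odd_line_vanish:
  assumes n: "n = 6 * m" "m \<ge> 2" and f: "f \<in> boroczky_ideal n" "degree_le f D" "D < 2 * m"
    and j: "odd j" "j < n" and q: "q \<in> boroczky_line n j" and "c \<noteq> 0"
  shows "eval_poly f (c *s vector [complex_of_real (q $ 1), complex_of_real (q $ 2), 1]) = 0"
proof -
  have n0: "n > 0" using n by simp
  define t where "t = pi * real j / real n"
  \<comment> \<open>\<open>a + s *s b\<close> is \<open>c\<close> times the homogeneous coordinate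
    vector of \<open>line_param t s\<close>.\<close>
  define a :: "complex ^ 3" where
    "a = c *s vector [of_real (sin (3 * t) * sin t), of_real (sin (3 * t) * cos t), 1]"
  define b :: "complex ^ 3" where "b = c *s vector [of_real (cos t), of_real (- sin t), 0]"
  have emb: "c *s vector [complex_of_real (line_param t s $ 1), complex_of_real (line_param t s $ 2), 1] =
      a + of_real s *s b" for s
    by (simp add: vec_eq_iff forall_3 a_def b_def line_param_def algebra_simps)
  obtain p where p: "degree p \<le> D" "\<And>s. poly p s = eval_poly f (a + s *s b)"
    using eval_poly_on_line[OF f(2), where a = a and b = b] by blast
  define I where "I = (\<lambda>i. 2 * i) ` {..<3 * m} - {nat ((- 2 * int j) mod int n)}"
  have "card I \<ge> card ((\<lambda>i. 2 * i) ` {..<3 * m}) - card {nat ((- 2 * int j) mod int n)}"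
    unfolding I_def by (rule diff_card_le_card_Diff) simp
  also have "card ((\<lambda>i. 2 * i) ` {..<3 * m}) = 3 * m"
    by (subst card_image) (auto simp: inj_on_def)
  finally have cardI: "card I > D" using n f(3) by simp
  have ex: "\<exists>s k. odd k \<and> k < n \<and> n dvd i + j + k \<and> line_param t s \<in> triple_points n \<and>
       plane_complex (line_param t s) = zeta n (int i) + zeta n (int j) + zeta n (int k)"
    if "i \<in> I" for i
  proof -
    have i: "even i" "i < n" using that n by (auto simp: I_def)
    define k where "k = nat ((- int i - int j) mod int n)"
    have kint: "int k = (- int i - int j) mod int n" using n0 by (simp add: k_def)
    have "int k < int n" unfolding kint using n0 by (intro pos_mod_bound) simp
    then have kn: "k < n" by simp
    have kdvd: "int n dvd int i + int j + int k"
      unfolding kint minus_mult_div_eq_mod[symmetric] by simp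
    have "even (int i + int j + int k)"
      using kdvd n by (meson dvd_trans dvd_triv_left even_mult_iff even_numeral int_dvd_int_iff even_of_nat)
    then have k: "odd k" using i j by simp
    have "k \<noteq> j"
    proof
      assume "k = j"
      then have "int n dvd int i - (- 2 * int j)" using kdvd by (simp add: algebra_simps)
      then have "int i mod int n = (- 2 * int j) mod int n" by (simp add: mod_eq_dvd_iff)
      then have "i = nat ((- 2 * int j) mod int n)" using i by simp
      with that show False by (simp add: I_def)
    qed
    define w where "w = zeta n (int i) + zeta n (int j) + zeta n (int k)"
    define r :: "real ^ 2" where "r = vector [Re w, Im w]"
    have r: "plane_complex r = w" by (simp add: r_def plane_complex_def)
    have kdvd': "n dvd i + j + k" using kdvd by (metis int_dvd_int_iff of_nat_add)
    have "r \<in> triple_points n"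
      by (rule roots_of_unity_imp_triple_point[OF n0 i(2) j(2) kn _ _ _ kdvd' r[unfolded w_def]])
        (use i j k \<open>k \<noteq> j\<close> in auto)
    moreover have "r \<in> boroczky_line n j"
      using triple_point_mem_line_iff[OF n0 i(2) j(2) kn kdvd' j(2) r[unfolded w_def]] by simp
    then obtain s where "r = line_param t s"
      using mem_boroczky_line_iff_param[OF n0] by (auto simp: t_def)
    ultimately show ?thesis using k kn kdvd' r w_def by blast
  qed
  then obtain s k where sk: "\<And>i. i \<in> I \<Longrightarrow> odd (k i) \<and> k i < n \<and> n dvd i + j + k i \<and>
      line_param t (s i) \<in> triple_points n \<and>
      plane_complex (line_param t (s i)) = zeta n (int i) + zeta n (int j) + zeta n (int (k i))"
    by metis
  \<comment> \<open>Equal parameters give equal points, so \<open>i\<close> is one of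
    \<open>i'\<close>, \<open>j\<close>, \<open>k i'\<close>; of these only \<open>i'\<close> is
    even.\<close>
  have "inj_on s I"
  proof (rule inj_onI)
    fix i i' assume i: "i \<in> I" "i' \<in> I" "s i = s i'"
    have lt: "i < n" "i' < n" "even i" "even i'" using i n by (auto simp: I_def)
    have "line_param t (s i) \<in> boroczky_line n i"
      using triple_point_mem_line_iff[of n i j "k i" i "line_param t (s i)"] sk[OF i(1)] n0 lt j by blast
    then have "i \<in> {i', j, k i'}"
      using triple_point_mem_line_iff[of n i' j "k i'" i "line_param t (s i)"] sk[OF i(2)] n0 lt j i by auto
    then show "i = i'" using lt j sk[OF i(2)] by auto
  qed
  then have "inj_on (\<lambda>i. complex_of_real (s i)) I"
    by (auto simp: inj_on_def)
  then have card: "card ((\<lambda>i. complex_of_real (s i)) ` I) = card I"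
    by (rule card_image)
  have roots: "(\<lambda>i. complex_of_real (s i)) ` I \<subseteq> {x. poly p x = 0}"
    using sk f(1) \<open>c \<noteq> 0\<close> by (auto simp: p(2) emb[symmetric] mem_boroczky_ideal_iff)
  have "p = 0"
  proof (rule ccontr)
    assume "p \<noteq> 0"
    then have "card I \<le> degree p"
      using card_mono[OF poly_roots_finite roots] card card_poly_roots_bound[of p] by simp
    with cardI p(1) show False by simp
  qed
  moreover obtain s0 where "q = line_param t s0"
    using q mem_boroczky_line_iff_param[OF n0] by (auto simp: t_def)
  ultimately show ?thesis using p(2)[of "of_real s0"] by (simp add: emb)
qed

text \<open>A horizontal line that avoids all intersection heights crosses the \<open>3 * m\<close>
  odd lines at different points, more than the supposed degree allows. Odd indices exclude
  \<open>j = 0\<close>, the horizontal line.\<close>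

lemma boroczky_ideal_degree_ge:
  assumes n: "n = 6 * m" "m \<ge> 2" and f: "f \<in> boroczky_ideal n" "f \<noteq> 0"
  shows "2 * m \<le> total_degree f"
proof (rule ccontr)
  define D where "D = total_degree f"
  assume "\<not> 2 * m \<le> total_degree f"
  then have D: "D < 2 * m" "degree_le f D" by (simp_all add: D_def degree_le_total_degree)
  have n0: "n > 0" using n by simp
  define J where "J = (\<lambda>i. 2 * i + 1) ` {..<3 * m}"
  have J: "odd j" "j < n" if "j \<in> J" for j
    using that n by (auto simp: J_def)
  have cardJ: "card J = 3 * m"
    unfolding J_def by (subst card_image) (auto simp: inj_on_def)
  \<comment> \<open>\<open>B\<close> contains the heights of all intersection points of two lines, by \<open>cubic_two_roots\<close>.\<close>
  define B where "B = (\<lambda>(i, j). let x = zeta n (int i); y = zeta n (int j) in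
      Im ((x ^ 2 * y + x * y ^ 2 + 1) / (x * y))) ` ({..<n} \<times> {..<n})"
  have finB: "finite B" by (simp add: B_def)
  have horiz: "eval_poly f (c *s vector [x, complex_of_real b, 1]) = 0" if "c \<noteq> 0" "b \<notin> B" for c x b
  proof -
    define \<tau> where "\<tau> j = pi * real j / real n" for j
    have sin: "sin (\<tau> j) > 0" if "j \<in> J" for j
    proof (rule sin_gt_zero)
      have "j > 0" using J(1)[OF that] by (cases j) auto
      then show "0 < \<tau> j" using n0 by (simp add: \<tau>_def)
      show "\<tau> j < pi" using J(2)[OF that] n0 by (simp add: \<tau>_def field_simps)
    qed
    \<comment> \<open>\<open>a j\<close> is the abscissa where line \<open>j\<close> has height
      \<open>b\<close>.\<close>
    define a where "a j = (sin (3 * \<tau> j) - b * cos (\<tau> j)) / sin (\<tau> j)" for j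
    have mem: "vector [a j, b] \<in> boroczky_line n j" if "j \<in> J" for j
      using sin[OF that] by (simp add: mem_boroczky_line_iff[OF n0] \<tau>_def[symmetric] a_def)
    have "inj_on a J"
    proof (rule inj_onI, rule ccontr)
      fix i j assume ij: "i \<in> J" "j \<in> J" "a i = a j" "i \<noteq> j"
      let ?x = "zeta n (int i)" and ?y = "zeta n (int j)"
      define r :: "real ^ 2" where "r = vector [a i, b]"
      have "r \<in> boroczky_line n i" "r \<in> boroczky_line n j"
        using mem[OF ij(1)] mem[OF ij(2)] ij(3) by (simp_all add: r_def)
      moreover have "?x \<noteq> ?y" using J(2) ij zeta_nat_inj[OF n0] by blast
      ultimately have "plane_complex r * ?x * ?y = ?x ^ 2 * ?y + ?x * ?y ^ 2 + 1"
        by (intro cubic_two_roots) (simp_all add: mem_boroczky_line_iff_cubic[OF n0])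
      then have "plane_complex r = (?x ^ 2 * ?y + ?x * ?y ^ 2 + 1) / (?x * ?y)"
        by (simp add: field_simps)
      then have "b = Im ((?x ^ 2 * ?y + ?x * ?y ^ 2 + 1) / (?x * ?y))"
        by (simp add: plane_complex_def r_def complex_eq_iff)
      then have "b \<in> B"
        unfolding B_def using J(2)[OF ij(1)] J(2)[OF ij(2)] by (auto simp: Let_def intro!: image_eqI[of _ _ "(i, j)"])
      with that show False by simp
    qed
    then have "inj_on (\<lambda>j. complex_of_real (a j)) J" by (auto simp: inj_on_def)
    then have card: "card ((\<lambda>j. complex_of_real (a j)) ` J) = 3 * m"
      by (simp add: card_image cardJ)
    obtain p where p: "degree p \<le> D"
      "\<And>s. poly p s = eval_poly f (c *s vector [0, complex_of_real b, 1] + s *s (c *s vector [1, 0, 0]))"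
      using eval_poly_on_line[OF D(2), where a = "c *s vector [0, complex_of_real b, 1]" and b = "c *s vector [1, 0, 0]"]
      by blast
    have line: "c *s vector [0, complex_of_real b, 1] + s *s (c *s vector [1, 0, 0]) =
        (c *s vector [s, complex_of_real b, 1] :: complex ^ 3)" for s
      by (simp add: vec_eq_iff forall_3)
    note p(2)[unfolded line]
    note p = p(1) this
    have roots: "(\<lambda>j. complex_of_real (a j)) ` J \<subseteq> {x. poly p x = 0}"
      using odd_line_vanish[OF n f(1) D(2,1) J mem \<open>c \<noteq> 0\<close>] by (auto simp: p(2))
    have "p = 0"
    proof (rule ccontr)
      assume "p \<noteq> 0"
      then have "3 * m \<le> degree p"
        using card_mono[OF poly_roots_finite roots] card card_poly_roots_bound[of p] by simp
      with D(1) p(1) show False by simp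
    qed
    then show ?thesis using p(2)[of x] by simp
  qed
  \<comment> \<open>With \<open>x\<close> fixed, the real heights outside \<open>B\<close> are
    infinitely many zeros in \<open>y\<close>.\<close>
  have all: "eval_poly f (c *s vector [x, y, 1]) = 0" if "c \<noteq> 0" for c x y
  proof -
    obtain p where p: "degree p \<le> D"
      "\<And>s. poly p s = eval_poly f (c *s vector [x, 0, 1] + s *s (c *s vector [0, 1, 0]))"
      using eval_poly_on_line[OF D(2), where a = "c *s vector [x, 0, 1]" and b = "c *s vector [0, 1, 0]"]
      by blast
    have line: "c *s vector [x, 0, 1] + s *s (c *s vector [0, 1, 0]) =
        (c *s vector [x, s, 1] :: complex ^ 3)" for s
      by (simp add: vec_eq_iff forall_3)
    note p = p(2)[unfolded line]
    have "infinite (UNIV - B)"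
      using finB infinite_UNIV_char_0 by (metis Diff_infinite_finite)
    then have "infinite (complex_of_real ` (UNIV - B))"
      by (simp add: finite_image_iff inj_on_def)
    moreover have "complex_of_real ` (UNIV - B) \<subseteq> {x. poly p x = 0}"
      using horiz[OF that] by (auto simp: p)
    ultimately have "p = 0"
      using poly_roots_finite finite_subset by blast
    then show ?thesis using p[of y] by simp
  qed
  have "f = 0"
  proof (rule eval_poly_vanish_imp_zero)
    \<comment> \<open>Points with last coordinate 0 are not covered by \<open>all\<close>; omitting
      them leaves enough test points.\<close>
    show "infinite (UNIV - {0 :: complex})"
      using infinite_UNIV_char_0 by (metis Diff_infinite_finite finite.emptyI finite.insertI)
    fix x y z :: complex assume "z \<in> UNIV - {0}"
    then have "vector [x, y, z] = (z *s vector [x / z, y / z, 1] :: complex ^ 3)" "z \<noteq> 0"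
      by (simp_all add: vec_eq_iff forall_3)
    then show "eval_poly f (vector [x, y, z]) = 0" using all by simp
  qed
  with f(2) show False by simp
qed

section \<open>The upper bound\<close>

text \<open>At \<open>u = x + iy\<close> these are \<open>x^2 + y^2\<close> and
  \<open>x^3 - 3xy^2\<close>, unchanged by conjugation and by cube roots of unity as
  factors.\<close>

definition dihedral_invariants :: "complex \<Rightarrow> real \<times> real" where
  "dihedral_invariants u = ((cmod u)^2, Re (u ^ 3))"

lemma dihedral_invariants_cnj: "dihedral_invariants (cnj u) = dihedral_invariants u"
  by (simp add: dihedral_invariants_def complex_cnj_power[symmetric] del: complex_cnj_power)

section \<open>Reduction of triple points to orbit representatives\<close>

lemma zeta_third_cubed:
  assumes "m > 0"
  shows "zeta (6 * m) (2 * int m * s) ^ 3 = 1"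
proof -
  have "zeta (6 * m) (2 * int m * s) ^ 3 = zeta (6 * m) (2 * int m * s + 2 * int m * s + 2 * int m * s)"
    by (simp only: zeta_add power3_eq_cube)
  also have "\<dots> = 1"
    by (subst zeta_eq_1_iff) (use assms in auto)
  finally show ?thesis .
qed

lemma dihedral_invariants_rotate:
  assumes "m > 0"
  shows "dihedral_invariants (zeta (6 * m) (2 * int m * s) * w) = dihedral_invariants w"
proof -
  have "cmod (zeta (6 * m) (2 * int m * s)) = 1" by (simp add: zeta_def)
  then show ?thesis
    by (simp add: dihedral_invariants_def norm_mult power_mult_distrib zeta_third_cubed[OF assms])
qed

text \<open>Here \<open>\<zeta> i\<close> is a cube root of unity. Factoring it out makes the other
  two summands conjugate, so the sum is this cube root times a real number.\<close>

lemma Im_cube_eq_0_on_axis: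
  assumes "m > 0" "6 * int m dvd i + j + k" "2 * int m dvd i"
  defines "\<zeta> \<equiv> zeta (6 * m)"
  shows "Im ((\<zeta> i + \<zeta> j + \<zeta> k) ^ 3) = 0"
proof -
  obtain s where i: "i = 2 * int m * s" using assms(3) by auto
  define a where "a = j - i"
  have "int (6 * m) dvd (k - i) - (- a)"
  proof -
    have "(k - i) - (- a) = (i + j + k) - 6 * int m * s" by (simp add: a_def i)
    then have "6 * int m dvd (k - i) - (- a)"
      using dvd_diff[OF assms(2), of "6 * int m * s"] by (simp only: dvd_triv_left)
    then show ?thesis by simp
  qed
  then have k: "\<zeta> (k - i) = cnj (\<zeta> a)"
    unfolding \<zeta>_def cnj_zeta using zeta_eq_iff[of "6 * m"] assms(1) by simp
  have "\<zeta> i + \<zeta> j + \<zeta> k = \<zeta> i * (1 + \<zeta> a + \<zeta> (k - i))"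
    by (simp add: \<zeta>_def a_def distrib_left zeta_add[symmetric])
  also have "1 + \<zeta> a + \<zeta> (k - i) = of_real (1 + 2 * Re (\<zeta> a))"
    unfolding k by (simp add: complex_eq_iff)
  finally have "(\<zeta> i + \<zeta> j + \<zeta> k) ^ 3 = of_real ((1 + 2 * Re (\<zeta> a)) ^ 3)"
    by (simp add: power_mult_distrib \<zeta>_def i zeta_third_cubed[OF assms(1)])
  then show ?thesis by (simp only: Im_complex_of_real)
qed

text \<open>
  Write the indices of a triple point off the axes as \<open>2ms + r\<close> with \<open>0 < r < 2m\<close>. Up to a reflection the
  residues \<open>r\<close> add up to \<open>2m\<close>; then exactly two of the sectors \<open>s\<close> agree modulo \<open>3\<close>, and rotating these
  two to \<open>s = 0\<close> gives the indices \<open>(a, b, -a-b)\<close>.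
\<close>

definition orbit_reps :: "nat \<Rightarrow> (nat \<times> nat) set" where
  "orbit_reps m = {(a, b). 0 < a \<and> a < b \<and> a + b < 2 * m}"

definition orbit_rep_point :: "nat \<Rightarrow> nat \<times> nat \<Rightarrow> complex" where
  "orbit_rep_point m = (\<lambda>(a, b). let \<zeta> = zeta (6 * m) in
    \<zeta> (int a) + \<zeta> (int b) + \<zeta> (- int a - int b))"

text \<open>The index sum gives \<open>s3\<close> congruent to \<open>s1 - 1\<close> modulo 3.
  Factoring out the rotation by \<open>s1\<close> therefore leaves the indices \<open>r1\<close>,
  \<open>r2\<close> and \<open>r3 - 2m = - r1 - r2\<close>. Distinct roots force \<open>r1\<close>
  and \<open>r2\<close> to differ, so they can be ordered.\<close>

lemma orbit_rep_if_sectors_cong: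
  assumes "m > 0" "6 * int m dvd i + j + k" "\<not> 6 * int m dvd i - j"
    and i: "i = 2 * int m * s1 + r1" and j: "j = 2 * int m * s2 + r2" and k: "k = 2 * int m * s3 + r3"
    and "r1 > 0" "r2 > 0" "r3 > 0" and r: "r1 + r2 + r3 = 2 * int m" and s: "3 dvd s1 - s2"
  defines "\<zeta> \<equiv> zeta (6 * m)"
  shows "\<exists>q\<in>orbit_reps m. dihedral_invariants (\<zeta> i + \<zeta> j + \<zeta> k) = dihedral_invariants (orbit_rep_point m q)"
proof -
  have n0: "6 * m > 0" using assms(1) by simp
  have "2 * int m * 3 dvd 2 * int m * (s1 + s2 + s3 + 1)"
  proof -
    have "i + j + k = 2 * int m * (s1 + s2 + s3 + 1)"
      using r by (simp add: i j k algebra_simps)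
    then show ?thesis using assms(2) by simp
  qed
  then have s3: "3 dvd s1 + s2 + s3 + 1"
    using assms(1) by (simp only: dvd_mult_cancel_left) simp
  have ne: "r1 \<noteq> r2"
  proof
    assume "r1 = r2"
    then have "i - j = 2 * int m * (s1 - s2)" by (simp add: i j algebra_simps)
    moreover have "2 * int m * 3 dvd 2 * int m * (s1 - s2)" using s by (intro mult_dvd_mono dvd_refl)
    ultimately show False using assms(3) by simp
  qed
  have j': "\<zeta> j = \<zeta> (2 * int m * s1) * \<zeta> r2"
  proof -
    have "2 * int m * 3 dvd 2 * int m * (s2 - s1)"
      using s by (metis dvd_minus_iff minus_diff_eq mult_dvd_mono dvd_refl)
    then have "6 * int m dvd j - (2 * int m * s1 + r2)" by (simp add: j algebra_simps)
    then have "\<zeta> j = \<zeta> (2 * int m * s1 + r2)"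
      unfolding \<zeta>_def using zeta_eq_iff[OF n0] by simp
    then show ?thesis by (simp add: \<zeta>_def zeta_add)
  qed
  have k': "\<zeta> k = \<zeta> (2 * int m * s1) * \<zeta> (- r1 - r2)"
  proof -
    have "3 dvd s3 - s1 + 1" using s s3 by presburger
    then have "2 * int m * 3 dvd 2 * int m * (s3 - s1 + 1)" by (intro mult_dvd_mono dvd_refl)
    moreover have "k - (2 * int m * s1 + (- r1 - r2)) = 2 * int m * (s3 - s1 + 1)"
      using r by (simp add: k algebra_simps)
    ultimately have "6 * int m dvd k - (2 * int m * s1 + (- r1 - r2))" by simp
    then have "\<zeta> k = \<zeta> (2 * int m * s1 + (- r1 - r2))"
      unfolding \<zeta>_def using zeta_eq_iff[OF n0] by simp
    then show ?thesis unfolding \<zeta>_def zeta_add .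
  qed
  have "\<zeta> i = \<zeta> (2 * int m * s1) * \<zeta> r1" by (simp add: \<zeta>_def i zeta_add)
  then have "\<zeta> i + \<zeta> j + \<zeta> k = \<zeta> (2 * int m * s1) * (\<zeta> r1 + \<zeta> r2 + \<zeta> (- r1 - r2))"
    by (simp add: j' k' distrib_left)
  then have inv: "dihedral_invariants (\<zeta> i + \<zeta> j + \<zeta> k) =
      dihedral_invariants (\<zeta> r1 + \<zeta> r2 + \<zeta> (- r1 - r2))"
    unfolding \<zeta>_def by (simp only: dihedral_invariants_rotate[OF assms(1)])
  show ?thesis
  proof (cases "r1 < r2")
    case True
    then show ?thesis
      by (intro bexI[of _ "(nat r1, nat r2)"])
        (use assms(7-9) r in \<open>auto simp: inv[unfolded \<zeta>_def] orbit_rep_point_def orbit_reps_def \<zeta>_def Let_def\<close>)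
  next
    case False
    have comm: "- r1 - r2 = - r2 - r1" by simp
    then have "\<zeta> r1 + \<zeta> r2 + \<zeta> (- r1 - r2) = orbit_rep_point m (nat r2, nat r1)"
      unfolding comm using assms(7,8) by (simp add: orbit_rep_point_def \<zeta>_def Let_def)
    moreover have "(nat r2, nat r1) \<in> orbit_reps m"
      using False ne assms(7-9) r by (auto simp: orbit_reps_def)
    ultimately show ?thesis using inv by metis
  qed
qed

text \<open>The sectors sum to -1 modulo 3, whereas three pairwise incongruent sectors would sum to
  0. So two agree, and a permutation moves them to the front.\<close>

lemma orbit_rep_if_residue_sum:
  assumes "m > 0" "6 * int m dvd i + j + k"
    and ne: "\<not> 6 * int m dvd i - j" "\<not> 6 * int m dvd i - k" "\<not> 6 * int m dvd j - k"
    and i: "i = 2 * int m * s1 + r1" and j: "j = 2 * int m * s2 + r2" and k: "k = 2 * int m * s3 + r3"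
    and rpos: "r1 > 0" "r2 > 0" "r3 > 0" and r: "r1 + r2 + r3 = 2 * int m"
  defines "\<zeta> \<equiv> zeta (6 * m)"
  shows "\<exists>q\<in>orbit_reps m. dihedral_invariants (\<zeta> i + \<zeta> j + \<zeta> k) = dihedral_invariants (orbit_rep_point m q)"
proof -
  have "2 * int m * 3 dvd 2 * int m * (s1 + s2 + s3 + 1)"
  proof -
    have "i + j + k = 2 * int m * (s1 + s2 + s3 + 1)"
      using r by (simp add: i j k algebra_simps)
    then show ?thesis using assms(2) by simp
  qed
  then have "3 dvd s1 + s2 + s3 + 1"
    using assms(1) by (simp only: dvd_mult_cancel_left) simp
  then have "3 dvd s1 - s2 \<or> 3 dvd s1 - s3 \<or> 3 dvd s2 - s3" by presburger
  then consider "3 dvd s1 - s2" | "3 dvd s1 - s3" | "3 dvd s2 - s3" by blast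
  then show ?thesis
  proof cases
    case 1
    from orbit_rep_if_sectors_cong[OF assms(1,2) ne(1) i j k rpos r 1] show ?thesis by (simp add: \<zeta>_def)
  next
    case 2
    have "6 * int m dvd i + k + j" "r1 + r3 + r2 = 2 * int m" using assms(2) r by (simp_all add: add_ac)
    from orbit_rep_if_sectors_cong[OF assms(1) this(1) ne(2) i k j rpos(1,3,2) this(2) 2]
    show ?thesis by (simp add: \<zeta>_def add_ac)
  next
    case 3
    have "6 * int m dvd j + k + i" "r2 + r3 + r1 = 2 * int m" using assms(2) r by (simp_all add: add_ac)
    from orbit_rep_if_sectors_cong[OF assms(1) this(1) ne(3) j k i rpos(2,3,1) this(2) 3]
    show ?thesis by (simp add: \<zeta>_def add_ac)
  qed
qed

text \<open>Off the axes the residues are positive, so their sum is a multiple of \<open>2m\<close>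
  strictly between 0 and \<open>6m\<close>. Conjugation reduces the value \<open>4m\<close> to
  \<open>2m\<close>.\<close>

lemma on_axis_or_orbit_rep:
  assumes "m > 0" and sum: "6 * int m dvd i + j + k"
    and ne: "\<not> 6 * int m dvd i - j" "\<not> 6 * int m dvd i - k" "\<not> 6 * int m dvd j - k"
  defines "u \<equiv> zeta (6 * m) i + zeta (6 * m) j + zeta (6 * m) k"
  shows "Im (u ^ 3) = 0 \<or> (\<exists>q\<in>orbit_reps m. dihedral_invariants u = dihedral_invariants (orbit_rep_point m q))"
proof -
  define M where "M = 2 * int m"
  have M: "M > 0" using assms(1) by (simp add: M_def)
  consider "M dvd i" | "M dvd j" | "M dvd k" | "\<not> M dvd i" "\<not> M dvd j" "\<not> M dvd k" by blast
  then show ?thesis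
  proof cases
    case 1
    then show ?thesis using Im_cube_eq_0_on_axis[OF assms(1) sum] by (simp add: u_def M_def)
  next
    case 2
    then show ?thesis using Im_cube_eq_0_on_axis[of m j i k] assms(1) sum by (simp add: u_def M_def add_ac)
  next
    case 3
    then show ?thesis using Im_cube_eq_0_on_axis[of m k i j] assms(1) sum by (simp add: u_def M_def add_ac)
  next
    case 4
    define r1 r2 r3 where "r1 = i mod M" and "r2 = j mod M" and "r3 = k mod M"
    have "x mod M \<ge> 0" "x mod M < M" for x using M by simp_all
    moreover have "r1 \<noteq> 0" "r2 \<noteq> 0" "r3 \<noteq> 0" using 4 by (auto simp: r1_def r2_def r3_def dvd_eq_mod_eq_0)
    ultimately have r: "0 < r1" "r1 < M" "0 < r2" "r2 < M" "0 < r3" "r3 < M"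
      unfolding r1_def r2_def r3_def by (simp_all add: order_less_le)
    have e: "i = M * (i div M) + r1" "j = M * (j div M) + r2" "k = M * (k div M) + r3"
      by (simp_all add: r1_def r2_def r3_def)
    have "M dvd i + j + k" using sum unfolding M_def by (rule dvd_trans[rotated]) auto
    moreover have "i + j + k = M * (i div M + j div M + k div M) + (r1 + r2 + r3)"
      using e by (simp add: algebra_simps)
    ultimately have "M dvd r1 + r2 + r3" by (metis dvd_add_right_iff dvd_triv_left)
    then obtain t where t: "r1 + r2 + r3 = M * t" by auto
    have "M * 0 < M * t" "M * t < M * 3" using t r by linarith+
    then have "0 < t" "t < 3" using M by (simp_all only: mult_less_cancel_left_pos)
    then consider "t = 1" | "t = 2" by linarith
    then show ?thesis
    proof cases
      case 1
      then have "r1 + r2 + r3 = 2 * int m" using t by (simp add: M_def)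
      from orbit_rep_if_residue_sum[OF assms(1) sum ne e[unfolded M_def] r(1,3,5) this]
      show ?thesis by (simp add: u_def)
    next
      case 2
      have sum': "6 * int m dvd - i + - j + - k"
        using sum by (metis dvd_minus_iff minus_add_distrib)
      have ne': "\<not> 6 * int m dvd - i - - j" "\<not> 6 * int m dvd - i - - k" "\<not> 6 * int m dvd - j - - k"
        using ne by (metis dvd_minus_iff minus_diff_eq minus_diff_minus)+
      \<comment> \<open>Negated indices have residues \<open>M - r\<close>, whose sum is
        \<open>3M - 2M = M\<close>.\<close>
      have e': "- i = M * (- (i div M) - 1) + (M - r1)" "- j = M * (- (j div M) - 1) + (M - r2)"
        "- k = M * (- (k div M) - 1) + (M - r3)"
        using e by (simp_all add: algebra_simps)
      have "2 * int m - r1 + (2 * int m - r2) + (2 * int m - r3) = 2 * int m"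
        using t 2 by (simp add: M_def)
      from orbit_rep_if_residue_sum[OF assms(1) sum' ne' e'[unfolded M_def] _ _ _ this] r[unfolded M_def]
      have "\<exists>q\<in>orbit_reps m. dihedral_invariants (cnj u) = dihedral_invariants (orbit_rep_point m q)"
        by (simp add: u_def cnj_zeta)
      then show ?thesis by (simp add: dihedral_invariants_cnj)
    qed
  qed
qed

text \<open>For each \<open>a\<close> there are \<open>2m - 2a - 1\<close> choices of
  \<open>b\<close>; the total is the sum of the first \<open>m - 1\<close> odd numbers.\<close>

lemma card_orbit_reps:
  assumes "m > 0"
  shows "finite (orbit_reps m)" "card (orbit_reps m) = (m - 1)^2"
proof -
  have eq: "orbit_reps m = (SIGMA a:{1..<m}. {a+1..<2*m-a})"
    by (auto simp: orbit_reps_def)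
  show "finite (orbit_reps m)" unfolding eq by auto
  have "(\<Sum>a\<in>{1..<m}. 2 * m - a - (a + 1)) = (m - 1)^2"
    using assms
  proof (induction m rule: nat_induct_non_zero)
    case (Suc m)
    have "(\<Sum>a\<in>{1..<Suc m}. 2 * Suc m - a - (a + 1)) = (\<Sum>a\<in>{1..<m}. 2 * Suc m - a - (a + 1)) + 1"
      using Suc.hyps by simp
    also have "(\<Sum>a\<in>{1..<m}. 2 * Suc m - a - (a + 1)) = (\<Sum>a\<in>{1..<m}. (2 * m - a - (a + 1)) + 2)"
      by (rule sum.cong) auto
    also have "\<dots> = (m - 1)^2 + 2 * (m - 1)"
      by (subst sum.distrib) (use Suc.IH in simp)
    finally show ?case using Suc.hyps by (cases m) (simp_all add: power2_eq_square)
  qed simp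
  then show "card (orbit_reps m) = (m - 1)^2" unfolding eq by (subst card_SigmaI) auto
qed

text \<open>Every pair \<open>(P, Q)\<close> with \<open>P\<close> nonzero and \<open>Q^2\<close>
  different from \<open>P^3\<close> comes from some \<open>(x, y)\<close>. The first factor is
  nonzero there, as its square is \<open>P^3 - Q^2\<close>, so the coefficients can be read off in
  \<open>P\<close> and \<open>Q\<close>.\<close>

lemma invariant_sum_vanish_imp_coeffs_zero:
  fixes c :: "nat \<times> nat \<Rightarrow> complex"
  assumes "finite T"
    and vanish: "\<And>x y. (3 * x ^ 2 * y - y ^ 3) *
          (\<Sum>t\<in>T. c t * (x ^ 2 + y ^ 2) ^ fst t * (x ^ 3 - 3 * x * y ^ 2) ^ snd t) = 0"
    and "t \<in> T"
  shows "c t = 0"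
proof -
  have van: "(\<Sum>t\<in>T. c t * P ^ fst t * Q ^ snd t) = 0" if P: "P \<noteq> 0" and Q: "Q \<in> {Q. Q ^ 2 \<noteq> P ^ 3}" for P Q
  proof -
    \<comment> \<open>With \<open>U = x + \<i>y\<close> and \<open>V = x - \<i>y\<close> the invariants are \<open>P = UV\<close> and \<open>2Q = U\<^sup>3 + V\<^sup>3\<close>.\<close>
    define w where "w = csqrt (Q ^ 2 - P ^ 3)"
    have w: "w ^ 2 = Q ^ 2 - P ^ 3" "w \<noteq> 0" using Q by (auto simp: w_def)
    have "Q + w \<noteq> 0"
    proof
      assume "Q + w = 0"
      then have "P ^ 3 = 0" using w(1) by algebra
      with P show False by simp
    qed
    \<comment> \<open>\<open>U^3\<close> and \<open>V^3\<close> must have sum \<open>2Q\<close> and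
      product \<open>P^3\<close>, hence be \<open>Q + w\<close> and \<open>Q - w\<close>.\<close>
    define U where "U = exp (Ln (Q + w) / 3)"
    have U0: "U \<noteq> 0" by (simp add: U_def)
    have U: "U ^ 3 = Q + w"
      using \<open>Q + w \<noteq> 0\<close> by (simp add: U_def exp_of_nat_mult[symmetric])
    define V where "V = P / U"
    have UV: "U * V = P" using U0 by (simp add: V_def)
    have "U ^ 3 * V ^ 3 = P ^ 3" by (simp add: UV[symmetric] power_mult_distrib)
    also have "\<dots> = U ^ 3 * (Q - w)"
      using w(1) unfolding U by (simp add: algebra_simps power2_eq_square)
    finally have "U ^ 3 * (V ^ 3 - (Q - w)) = 0" by (simp add: right_diff_distrib)
    then have V: "V ^ 3 = Q - w" using U0 by simp
    define x where "x = (U + V) / 2"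
    define y where "y = - \<i> * (U - V) / 2"
    have xy: "2 * x = U + V" "2 * y = - \<i> * (U - V)" "\<i> ^ 2 = -1" by (simp_all add: x_def y_def)
    have "4 * (x ^ 2 + y ^ 2) = 4 * P" using xy UV by algebra
    moreover have "8 * (x ^ 3 - 3 * x * y ^ 2) = 8 * Q" using xy U V by algebra
    moreover have "8 * (3 * x ^ 2 * y - y ^ 3) = 8 * (- \<i> * w)" using xy U V by algebra
    ultimately have eq: "x ^ 2 + y ^ 2 = P" "x ^ 3 - 3 * x * y ^ 2 = Q" "3 * x ^ 2 * y - y ^ 3 = - \<i> * w"
      by (metis mult_cancel_left zero_neq_numeral)+
    show ?thesis using vanish[of x y] w(2) unfolding eq by simp
  qed
  obtain k l where t: "t = (k, l)" by (cases t)
  \<comment> \<open>For fixed \<open>P\<close> only the square roots of \<open>P^3\<close> are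
    excluded as \<open>Q\<close>, so the \<open>Q\<close>-exponent is isolated first.\<close>
  have P: "(\<Sum>t\<in>{t \<in> T. snd t = l}. c t * P ^ fst t) = 0" if "P \<in> UNIV - {0}" for P
  proof (rule sum_powers_vanish_on_infinite[OF assms(1)])
    have "- {Q. Q ^ 2 \<noteq> P ^ 3} \<subseteq> {csqrt (P ^ 3), - csqrt (P ^ 3)}"
      using power2_eq_iff[of _ "csqrt (P ^ 3)"] by auto
    then have "finite (- {Q. Q ^ 2 \<noteq> P ^ 3})" by (rule finite_subset) simp
    then show "infinite {Q. Q ^ 2 \<noteq> P ^ 3}"
      using infinite_UNIV_char_0[where 'a = complex] by (metis finite_Un Compl_partition)
  qed (use van that in auto)
  have "infinite (UNIV - {0 :: complex})" "finite {t \<in> T. snd t = l}"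
    using infinite_UNIV_char_0[where 'a = complex] assms(1) by simp_all
  then have "(\<Sum>t\<in>{t \<in> {t \<in> T. snd t = l}. fst t = k}. c t) = 0"
    using sum_powers_vanish_on_infinite P by blast
  moreover have "{t \<in> {t \<in> T. snd t = l}. fst t = k} = {t}"
    using assms(3) t by auto
  ultimately show ?thesis by simp
qed

lemma boroczky_ideal_element:
  assumes n: "n = 6 * m" "m > 0" and card: "(m - 1)^2 < card (weighted_exponents d)"
  shows "\<exists>f\<in>boroczky_ideal n. f \<noteq> 0 \<and> total_degree f \<le> d + 3"
proof -
  let ?T = "weighted_exponents d"
  \<comment> \<open>Row \<open>q\<close> expresses that the invariant with \<open>z = 1\<close>
    vanishes at representative \<open>q\<close>, hence on its whole orbit.\<close>
  define M :: "nat \<times> nat \<Rightarrow> nat \<times> nat \<Rightarrow> complex"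
    where "M q t = (case dihedral_invariants (orbit_rep_point m q) of (a, b) \<Rightarrow>
      of_real a ^ fst t * of_real b ^ snd t)" for q t
  obtain c where c: "\<exists>t\<in>?T. c t \<noteq> 0" "\<forall>q\<in>orbit_reps m. (\<Sum>t\<in>?T. M q t * c t) = 0"
    using underdetermined_system[of "orbit_reps m" ?T M] card card_orbit_reps[OF n(2)] finite_weighted_exponents
    by auto
  define x y z where "x = Var 1" and "y = Var 2" and "z = Var 3"
  \<comment> \<open>\<open>A\<close> is the product of the three axes, \<open>Im ((x + \<i>y)\<^sup>3)\<close>.\<close>
  define A where "A = Const 3 * x ^ 2 * y + Const (-1) * y ^ 3"
  define P where "P = x ^ 2 + y ^ 2"
  define Q where "Q = x ^ 3 + Const (-3) * x * y ^ 2"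
  \<comment> \<open>The power of \<open>z\<close> pads every term to degree \<open>d\<close>; the
    truncated subtraction is exact on \<open>?T\<close>.\<close>
  define f where "f = A * (\<Sum>t\<in>?T. Const (c t) * z ^ (d - 2 * fst t - 3 * snd t) * P ^ fst t * Q ^ snd t)"
  have eval: "eval_poly f v = (3 * (v $ 1) ^ 2 * v $ 2 - (v $ 2) ^ 3) *
      (\<Sum>t\<in>?T. c t * (v $ 3) ^ (d - 2 * fst t - 3 * snd t) * ((v $ 1) ^ 2 + (v $ 2) ^ 2) ^ fst t *
         ((v $ 1) ^ 3 - 3 * v $ 1 * (v $ 2) ^ 2) ^ snd t)" for v
    by (simp add: f_def A_def P_def Q_def x_def y_def z_def eval_poly_mult eval_poly_add eval_poly_power eval_poly_sum)
  have deg: "degree_le x 1" "degree_le y 1" "degree_le z 1"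
    unfolding x_def y_def z_def by (rule degree_le_Var)+
  note pow = degree_le_power[OF deg(1)] degree_le_power[OF deg(2)]
  have mono: "degree_le (Const 3 * x ^ 2 * y) 3" "degree_le (Const (-1) * y ^ 3) 3"
    "degree_le (Const (-3) * x * y ^ 2) 3"
    using degree_le_mult[OF degree_le_mult[OF degree_le_Const[of 3 0] pow(1)[of 2]] deg(2)]
      degree_le_mult[OF degree_le_Const[of "-1" 0] pow(2)[of 3]]
      degree_le_mult[OF degree_le_mult[OF degree_le_Const[of "-3" 0] deg(1)] pow(2)[of 2]]
    by (simp_all add: numeral_3_eq_3)
  have degA: "degree_le A 3"
    unfolding A_def by (rule degree_le_add[OF mono(1,2)])
  have degP: "degree_le P 2"
    unfolding P_def using degree_le_add[OF pow(1)[of 2] pow(2)[of 2]] by simp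
  have degQ: "degree_le Q 3"
    unfolding Q_def using degree_le_add[OF _ mono(3)] pow(1)[of 3] by simp
  have "degree_le (\<Sum>t\<in>?T. Const (c t) * z ^ (d - 2 * fst t - 3 * snd t) * P ^ fst t * Q ^ snd t) d"
  proof (rule degree_le_sum)
    fix t assume "t \<in> ?T"
    then have "2 * fst t + 3 * snd t \<le> d" by (auto simp: weighted_exponents_def)
    then have "0 + (d - 2 * fst t - 3 * snd t) * 1 + fst t * 2 + snd t * 3 = d" by simp
    then show "degree_le (Const (c t) * z ^ (d - 2 * fst t - 3 * snd t) * P ^ fst t * Q ^ snd t) d"
      using degree_le_mult[OF degree_le_mult[OF degree_le_mult[OF degree_le_Const[of "c t" 0]
            degree_le_power[OF deg(3)]] degree_le_power[OF degP]] degree_le_power[OF degQ]] by metis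
  qed
  then have degf: "degree_le f (d + 3)"
    unfolding f_def using degree_le_mult[OF degA] by (simp add: add.commute)
  have "f \<noteq> 0"
  proof
    assume "f = 0"
    have "c t = 0" if "t \<in> ?T" for t
    proof (rule invariant_sum_vanish_imp_coeffs_zero[OF finite_weighted_exponents _ that])
      fix X Y :: complex
      show "(3 * X ^ 2 * Y - Y ^ 3) *
          (\<Sum>t\<in>?T. c t * (X ^ 2 + Y ^ 2) ^ fst t * (X ^ 3 - 3 * X * Y ^ 2) ^ snd t) = 0"
        using eval[of "vector [X, Y, 1]"] \<open>f = 0\<close> by simp
    qed
    with c(1) show False by blast
  qed
  moreover have "f \<in> boroczky_ideal n"
    unfolding mem_boroczky_ideal_iff
  proof (intro ballI allI impI)
    fix p l assume p: "p \<in> triple_points n" and "l \<noteq> (0 :: complex)"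
    define u where "u = plane_complex p"
    define a b where "a = p $ 1" and "b = p $ 2"
    have n0: "n > 0" using n by simp
    obtain i j k where ijk: "i < n" "j < n" "k < n" "i \<noteq> j" "i \<noteq> k" "j \<noteq> k" "n dvd i + j + k"
      "plane_complex p = zeta n (int i) + zeta n (int j) + zeta n (int k)"
      using triple_point_imp_roots_of_unity[OF n0 p] .
    have ne: "\<not> 6 * int m dvd int i - int j" if "i < n" "j < n" "i \<noteq> j" for i j
      using that zeta_nat_inj[OF n0, of i j] zeta_eq_iff[OF n0, of "int i" "int j"] n(1) by auto
    have "6 * int m dvd int i + int j + int k"
      using ijk(7) unfolding n(1) by (metis int_dvd_int_iff of_nat_add of_nat_mult of_nat_numeral)
    from on_axis_or_orbit_rep[OF n(2) this ne[OF ijk(1,2,4)] ne[OF ijk(1,3,5)] ne[OF ijk(2,3,6)]]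
    have cases: "Im (u ^ 3) = 0 \<or> (\<exists>q\<in>orbit_reps m. dihedral_invariants u = dihedral_invariants (orbit_rep_point m q))"
      using ijk(8) n(1) by (simp add: u_def)
    have u: "cmod u ^ 2 = a ^ 2 + b ^ 2" "Re (u ^ 3) = a ^ 3 - 3 * a * b ^ 2" "Im (u ^ 3) = 3 * a ^ 2 * b - b ^ 3"
      by (simp_all add: u_def plane_complex_def a_def b_def cmod_def power3_eq_cube power2_eq_square algebra_simps)
    define S where "S = (\<Sum>t\<in>?T. c t * of_real (cmod u ^ 2) ^ fst t * of_real (Re (u ^ 3)) ^ snd t)"
    have "Im (u ^ 3) = 0 \<or> S = 0"
    proof (cases "Im (u ^ 3) = 0")
      case False
      then obtain q where q: "q \<in> orbit_reps m" "dihedral_invariants u = dihedral_invariants (orbit_rep_point m q)"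
        using cases by blast
      then have "S = (\<Sum>t\<in>?T. M q t * c t)"
        unfolding S_def M_def q(2)[symmetric] by (simp add: dihedral_invariants_def mult_ac)
      then show ?thesis using c(2) q(1) by simp
    qed simp
    \<comment> \<open>By homogeneity of degree \<open>d + 3\<close> the scalar \<open>l\<close>
      comes out as a power.\<close>
    moreover have "eval_poly f (l *s vector [complex_of_real a, complex_of_real b, 1]) =
        l ^ (d + 3) * of_real (Im (u ^ 3)) * S"
    proof -
      have "(\<Sum>t\<in>?T. c t * l ^ (d - 2 * fst t - 3 * snd t) * ((l * of_real a) ^ 2 + (l * of_real b) ^ 2) ^ fst t *
         ((l * of_real a) ^ 3 - 3 * (l * of_real a) * (l * of_real b) ^ 2) ^ snd t) = l ^ d * S"
        unfolding S_def sum_distrib_left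
      proof (rule sum.cong)
        fix t assume "t \<in> ?T"
        then have "2 * fst t + 3 * snd t \<le> d" by (auto simp: weighted_exponents_def)
        then have "d = (d - 2 * fst t - 3 * snd t) + 2 * fst t + 3 * snd t" by simp
        then have ld: "l ^ d = l ^ (d - 2 * fst t - 3 * snd t) * (l ^ 2) ^ fst t * (l ^ 3) ^ snd t"
          by (metis power_add power_mult)
        have h: "(l * of_real a) ^ 2 + (l * of_real b) ^ 2 = l ^ 2 * of_real (cmod u ^ 2)"
          "(l * of_real a) ^ 3 - 3 * (l * of_real a) * (l * of_real b) ^ 2 = l ^ 3 * of_real (Re (u ^ 3))"
          unfolding u by (simp_all add: power2_eq_square power3_eq_cube algebra_simps)
        show "c t * l ^ (d - 2 * fst t - 3 * snd t) * ((l * of_real a) ^ 2 + (l * of_real b) ^ 2) ^ fst t *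
         ((l * of_real a) ^ 3 - 3 * (l * of_real a) * (l * of_real b) ^ 2) ^ snd t =
          l ^ d * (c t * of_real (cmod u ^ 2) ^ fst t * of_real (Re (u ^ 3)) ^ snd t)"
          unfolding h ld by (simp only: power_mult_distrib mult_ac)
      qed simp
      moreover have "3 * (l * of_real a) ^ 2 * (l * of_real b) - (l * of_real b) ^ 3 = l ^ 3 * of_real (Im (u ^ 3))"
        unfolding u by (simp add: power2_eq_square power3_eq_cube algebra_simps)
      ultimately show ?thesis by (simp add: eval power_add)
    qed
    ultimately show "eval_poly f (l *s vector [complex_of_real (p $ 1), complex_of_real (p $ 2), 1]) = 0"
      unfolding a_def b_def by auto
  qed
  ultimately show ?thesis using total_degree_le degf by blast
qed

theorem corollary4p6:
  fixes n d :: nat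
  assumes "n \<ge> 12" and "6 dvd n"
    and "d = (LEAST k::nat. real_of_int \<lfloor>(real k)^2 / 12 + real k / 2\<rfloor> \<ge> (real n - 6)^2 / 36)"
  shows "real n / 3 \<le> real (initial_degree (boroczky_ideal n))
       \<and> initial_degree (boroczky_ideal n) \<le> d + 3"
proof -
  obtain m where n: "n = 6 * m" using assms(2) by auto
  with assms(1) have m: "m \<ge> 2" by simp
  have bound: "(real n - 6)^2 / 36 = (real m - 1)^2"
  proof -
    have "real n - 6 = 6 * (real m - 1)" by (simp add: n)
    then show ?thesis by (simp only: power_mult_distrib) simp
  qed
  \<comment> \<open>The value \<open>k = n\<close> satisfies the inequality, so the least number
    \<open>d\<close> does too.\<close>
  have "(real n)^2 / 12 + real n / 2 = of_int (3 * int m ^ 2 + 3 * int m)"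
    by (simp add: n power2_eq_square)
  then have "real_of_int \<lfloor>(real n)^2 / 12 + real n / 2\<rfloor> = 3 * real m ^ 2 + 3 * real m"
    by (simp only: floor_of_int) simp
  moreover have "(real m - 1)^2 \<le> 3 * real m ^ 2 + 3 * real m"
  proof -
    have "real m \<ge> 2" "real m ^ 2 \<ge> 0" using m by simp_all
    then show ?thesis unfolding power2_diff power_one mult_1_right by linarith
  qed
  ultimately have "real_of_int \<lfloor>(real n)^2 / 12 + real n / 2\<rfloor> \<ge> (real n - 6)^2 / 36"
    unfolding bound by simp
  then have "real_of_int \<lfloor>(real d)^2 / 12 + real d / 2\<rfloor> \<ge> (real n - 6)^2 / 36"
    unfolding assms(3) by (rule LeastI)
  then have "(real m - 1)^2 \<le> (real d)^2 / 12 + real d / 2"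
    unfolding bound using of_int_floor_le order.trans by blast
  also have "\<dots> < real (card (weighted_exponents d))"
    by (rule card_weighted_exponents_gt)
  finally have "real ((m - 1)^2) < real (card (weighted_exponents d))"
    using m by (simp add: of_nat_diff)
  then have "(m - 1)^2 < card (weighted_exponents d)" by simp
  then obtain f where f: "f \<in> boroczky_ideal n" "f \<noteq> 0" "total_degree f \<le> d + 3"
    using boroczky_ideal_element[OF n] m by auto
  let ?J = "\<lambda>e. \<exists>f\<in>boroczky_ideal n. f \<noteq> 0 \<and> total_degree f = e"
  have "initial_degree (boroczky_ideal n) \<le> total_degree f"
    unfolding initial_degree_def by (rule Least_le) (use f in blast)
  \<comment> \<open>The degree of \<open>f\<close> shows that the minimum is attained, so the bound
    for single elements applies to it.\<close>
  moreover have "?J (initial_degree (boroczky_ideal n))"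
    unfolding initial_degree_def by (rule LeastI[of ?J "total_degree f"]) (use f in blast)
  then have "2 * m \<le> initial_degree (boroczky_ideal n)"
    using boroczky_ideal_degree_ge[OF n m] by metis
  ultimately show ?thesis using f(3) n by simp
qed

end
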